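(* Let $n\ge1$, let $r_1>r_2>\cdots>r_n\ge0$ be integers, $\mathbf r=(r_1,\dots,r_n)$, and let $F_{\mathbf r}(q)$ be the coefficient of $t_1^{r_1+\frac12}\cdots t_n^{r_n+\frac12}$ in $F(t_1,\dots,t_n)$. Write $$\frac{F_{\mathbf r}(q)}{(q;q)_\infty}=\sum_{\ell\ge0}b_\ell q^\ell .$$ Then, as $\ell\to\infty$, $$b_\ell\sim\frac{p(\ell)}{2^n},$$ where $p(\ell)$ is the number of partitions of $\ell$.
   Context: $(q;q)_\infty=\prod_{m\ge1}(1-q^m)$. Fermionic Fock space: let $\psi(k+\tfrac12),\psi^*(k+\tfrac12)$, $k\in\mathbb Z$, satisfy $[\psi^*(\ell+\tfrac12),\psi(k+\tfrac12)]_+=\delta_{\ell+k+1,0}$ for $\ell,k\in\mathbb{Z}$, all other anticommutators being zero. $\mathcal F$ is the complex vector space generated from a vacuum vector $\mathbf 1$, annihilated by all $\psi(k+\tfrac12)$ and $\psi^*(k+\tfrac12)$ with $k\ge 0$, with basis the monomials $\psi(-n_a-\tfrac12)\cdots\psi(-n_1-\tfrac12)\psi^*(-m_b-\tfrac12)\cdots\psi^*(-m_1-\tfrac12)\mathbf 1$, where $n_a>\cdots>n_1\ge0$ and $m_b>\cdots>m_1\ge 0$. Such a monomial has charge $a-b$ and is an eigenvector of $L(0)$ with eigenvalue $\sum_i(n_i+\tfrac12)+\sum_i(m_i+\tfrac12)$. $\mathcal F_0$ is the span of the monomials of charge $0$. Let $A(t)=\sum_{\ell\in\mathbb Z}\psi^*(\ell+\tfrac12)\psi(-\ell-\tfrac12)\,t^{-\ell-\frac12}$,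 and define the Bloch-Okounkov $n$-point function (a formal series in the $t_j$, whose coefficients are power series in $q=e^{2\pi i\tau}$, $|q|<1$) by $$F(t_1,\dots,t_n)=\eta(\tau)\,\mathrm{tr}_{\mathcal F_0}A(t_1)\cdots A(t_n)\,q^{L(0)-\frac1{24}},\qquad \eta(\tau)=q^{\frac1{24}}\prod_{m\ge1}(1-q^m).$$ *)

theory Defs
  imports "HOL-Analysis.Analysis" "HOL-Library.Multiset" "HOL-Library.Landau_Symbols"
begin

definition nome :: "complex \<Rightarrow> complex" where
  "nome \<tau> = exp (2 * of_real pi * \<i> * \<tau>)"

definition euler_product :: "complex \<Rightarrow> complex" where
  "euler_product q = (\<Prod>m. 1 - q ^ Suc m)"

text \<open>Fractional powers of \<open>q = exp (2 \<pi> \<i> \<tau>)\<close> are taken as functions of \<open>\<tau>\<close>: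
  \<open>q\<^sup>c = exp (2 \<pi> \<i> \<tau> c)\<close>.\<close>

definition nome_pow :: "complex \<Rightarrow> real \<Rightarrow> complex" where
  "nome_pow \<tau> c = exp (2 * of_real pi * \<i> * \<tau> * of_real c)"

definition dedekind_eta :: "complex \<Rightarrow> complex" where
  "dedekind_eta \<tau> = nome_pow \<tau> (1 / 24) * euler_product (nome \<tau>)"

definition is_q_expansion :: "(nat \<Rightarrow> complex) \<Rightarrow> (complex \<Rightarrow> complex) \<Rightarrow> bool" where
  "is_q_expansion b f \<longleftrightarrow> (\<forall>\<tau>. Im \<tau> > 0 \<longrightarrow> (\<lambda>l. b l * nome \<tau> ^ l) sums f \<tau>)"

definition num_partitions :: "nat \<Rightarrow> nat" where
  "num_partitions l = card {P :: nat multiset. 0 \<notin># P \<and> sum_mset P = l}"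

text \<open>The integer \<open>k\<close> encodes the half-integer \<open>k + 1/2\<close>: \<open>psi k\<close> and \<open>psis k\<close> are
  \<open>\<psi>(k + 1/2)\<close> and \<open>\<psi>\<^sup>*(k + 1/2)\<close>. In particular \<open>\<psi>(- n - 1/2)\<close> is \<open>psi (- int n - 1)\<close>.\<close>

definition fock_monomial ::
  "(int \<Rightarrow> 'v \<Rightarrow> 'v) \<Rightarrow> (int \<Rightarrow> 'v \<Rightarrow> 'v) \<Rightarrow> 'v \<Rightarrow> nat list \<times> nat list \<Rightarrow> 'v" where
  "fock_monomial psi psis vac = (\<lambda>(ns, ms).
     foldr (\<lambda>n. psi (- int n - 1)) ns (foldr (\<lambda>m. psis (- int m - 1)) ms vac))"

definition fock_index :: "(nat list \<times> nat list) set" where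
  "fock_index = {(ns, ms). sorted_wrt (>) ns \<and> sorted_wrt (>) ms}"

definition fock_charge :: "nat list \<times> nat list \<Rightarrow> int" where
  "fock_charge = (\<lambda>(ns, ms). int (length ns) - int (length ms))"

definition fock_weight :: "nat list \<times> nat list \<Rightarrow> real" where
  "fock_weight = (\<lambda>(ns, ms). (\<Sum>n\<leftarrow>ns. real n + 1 / 2) + (\<Sum>m\<leftarrow>ms. real m + 1 / 2))"

locale fermionic_fock_space = vector_space scale
  for scale :: "complex \<Rightarrow> 'v::ab_group_add \<Rightarrow> 'v" (infixr \<open>*s\<close> 75) +
  fixes psi psis :: "int \<Rightarrow> 'v \<Rightarrow> 'v" and vac :: 'v
  assumes linear_psi: "Vector_Spaces.linear scale scale (psi k)"
    and linear_psis: "Vector_Spaces.linear scale scale (psis k)"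
    and anticomm_psis_psi:
      "psis l (psi k v) + psi k (psis l v) = (if l + k + 1 = 0 then v else 0)"
    and anticomm_psi_psi: "psi l (psi k v) + psi k (psi l v) = 0"
    and anticomm_psis_psis: "psis l (psis k v) + psis k (psis l v) = 0"
    and psi_vac: "k \<ge> 0 \<Longrightarrow> psi k vac = 0"
    and psis_vac: "k \<ge> 0 \<Longrightarrow> psis k vac = 0"
    and inj_monomial: "inj_on (fock_monomial psi psis vac) fock_index"
    and independent_monomials: "independent (fock_monomial psi psis vac ` fock_index)"
    and span_monomials: "span (fock_monomial psi psis vac ` fock_index) = UNIV"
begin

abbreviation monomial :: "nat list \<times> nat list \<Rightarrow> 'v" where
  "monomial \<equiv> fock_monomial psi psis vac"

definition coord :: "nat list \<times> nat list \<Rightarrow> 'v \<Rightarrow> complex" where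
  "coord s v = representation (monomial ` fock_index) v (monomial s)"

text \<open>The linear operator \<open>q\<^bsup>L(0) - 1/24\<^esup>\<close>, where \<open>L(0)\<close> is diagonal in the monomial basis
  with eigenvalues \<^const>\<open>fock_weight\<close>.\<close>

definition q_L0 :: "complex \<Rightarrow> 'v \<Rightarrow> 'v" where
  "q_L0 \<tau> v = (\<Sum>s | s \<in> fock_index \<and> coord s v \<noteq> 0.
     coord s v *s nome_pow \<tau> (fock_weight s - 1 / 24) *s monomial s)"

text \<open>The trace over \<open>\<F>\<^sub>0\<close> of an operator preserving the charge.\<close>

definition trace0 :: "('v \<Rightarrow> 'v) \<Rightarrow> complex" where
  "trace0 T = (\<Sum>\<^sub>\<infinity>s\<in>{s \<in> fock_index. fock_charge s = 0}. coord s (T (monomial s)))"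

text \<open>A formal series in half-integral powers of \<open>t\<close> is given by its coefficients, the coefficient
  of \<open>t\<^bsup>e + 1/2\<^esup>\<close> being indexed by the integer \<open>e\<close>. In \<open>A(t)\<close>, the exponent
  \<open>- l - 1/2\<close> is \<open>e + 1/2\<close> for \<open>l = - e - 1\<close>.\<close>

definition A_term :: "int \<Rightarrow> 'v \<Rightarrow> 'v" where
  "A_term l = psis l \<circ> psi (- l - 1)"

definition A_coeff :: "int \<Rightarrow> 'v \<Rightarrow> 'v" where
  "A_coeff e = A_term (- e - 1)"

text \<open>For \<open>es = [e\<^sub>1, \<dots>, e\<^sub>n]\<close>, the coefficient of
  \<open>t\<^sub>1\<^bsup>e\<^sub>1 + 1/2\<^esup> \<cdots> t\<^sub>n\<^bsup>e\<^sub>n + 1/2\<^esup>\<close> in the \<open>n\<close>-point function \<open>F(t\<^sub>1, \<dots>, t\<^sub>n)\<close>,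
  as a function of \<open>\<tau>\<close>.\<close>

definition npoint_coeff :: "int list \<Rightarrow> complex \<Rightarrow> complex" where
  "npoint_coeff es \<tau> =
     dedekind_eta \<tau> * trace0 (foldr (\<circ>) (map A_coeff es) id \<circ> q_L0 \<tau>)"

end


text \<open>A model of the axioms on \<^typ>\<open>complex poly\<close>: the monomial of degree \<open>c\<close> is the state whose
  set of occupied modes is the set of binary digits of \<open>c\<close>. The mode \<open>2 * m\<close> is created by
  \<open>\<psi>\<^sup>*(- m - 1/2)\<close>, the mode \<open>2 * n + 1\<close> by \<open>\<psi>(- n - 1/2)\<close>, and \<open>mode_less a b\<close> says that the
  creation operator of \<open>b\<close> stands to the left of that of \<open>a\<close> in a monomial.\<close>

definition mode_less :: "nat \<Rightarrow> nat \<Rightarrow> bool" where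
  "mode_less a b \<longleftrightarrow> (even a \<and> odd b) \<or> (even a = even b \<and> a < b)"

definition mode_sign :: "nat \<Rightarrow> nat set \<Rightarrow> complex" where
  "mode_sign a X = (- 1) ^ card {b \<in> X. mode_less a b}"

definition create_mode :: "nat \<Rightarrow> complex poly \<Rightarrow> complex poly" where
  "create_mode a v = Abs_poly (\<lambda>c. if a \<in> set_decode c
     then mode_sign a (set_decode c) * coeff v (set_encode (set_decode c - {a})) else 0)"

definition annihilate_mode :: "nat \<Rightarrow> complex poly \<Rightarrow> complex poly" where
  "annihilate_mode a v = Abs_poly (\<lambda>c. if a \<notin> set_decode c
     then mode_sign a (set_decode c) * coeff v (set_encode (insert a (set_decode c))) else 0)"

definition model_psi :: "int \<Rightarrow> complex poly \<Rightarrow> complex poly" where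
  "model_psi k = (if k < 0 then create_mode (2 * nat (- k - 1) + 1) else annihilate_mode (2 * nat k))"

definition model_psis :: "int \<Rightarrow> complex poly \<Rightarrow> complex poly" where
  "model_psis k = (if k < 0 then create_mode (2 * nat (- k - 1)) else annihilate_mode (2 * nat k + 1))"

lemma mode_sign_insert:
  assumes "finite X" "a \<notin> X"
  shows "mode_sign b (insert a X) = (if mode_less b a then - mode_sign b X else mode_sign b X)"
proof -
  have "{c \<in> insert a X. mode_less b c} =
      (if mode_less b a then insert a {c \<in> X. mode_less b c} else {c \<in> X. mode_less b c})"
    by auto
  with assms show ?thesis by (simp add: mode_sign_def)
qed

lemma mode_sign_square [simp]: "mode_sign a X * mode_sign a X = 1"
  by (simp add: mode_sign_def flip: power_add mult_2)

lemma mode_less_irrefl [simp]: "\<not> mode_less a a"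
  by (simp add: mode_less_def)

lemma mode_less_total: "a \<noteq> b \<Longrightarrow> mode_less a b \<longleftrightarrow> \<not> mode_less b a"
  by (auto simp: mode_less_def)

lemma set_encode_remove: "finite X \<Longrightarrow> a \<in> X \<Longrightarrow> set_encode X = set_encode (X - {a}) + 2 ^ a"
  using set_encode_insert[of "X - {a}" a] by (simp add: insert_absorb)

lemma coeff_create_mode:
  assumes "finite X"
  shows "coeff (create_mode a v) (set_encode X) =
    (if a \<in> X then mode_sign a X * coeff v (set_encode (X - {a})) else 0)"
proof -
  let ?f = "\<lambda>c. if a \<in> set_decode c
     then mode_sign a (set_decode c) * coeff v (set_encode (set_decode c - {a})) else 0"
  have "?f c = 0" if "c > degree v + 2 ^ a" for c
    using that set_encode_remove[of "set_decode c" a] by (auto simp: coeff_eq_0)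
  then have "coeff (create_mode a v) = ?f"
    unfolding create_mode_def by (intro coeff_Abs_poly[of "degree v + 2 ^ a"]) blast
  with assms show ?thesis by simp
qed

lemma coeff_annihilate_mode:
  assumes "finite X"
  shows "coeff (annihilate_mode a v) (set_encode X) =
    (if a \<notin> X then mode_sign a X * coeff v (set_encode (insert a X)) else 0)"
proof -
  let ?f = "\<lambda>c. if a \<notin> set_decode c
     then mode_sign a (set_decode c) * coeff v (set_encode (insert a (set_decode c))) else 0"
  have "?f c = 0" if "c > degree v" for c
    using that set_encode_insert[of "set_decode c" a] by (auto simp: coeff_eq_0)
  then have "coeff (annihilate_mode a v) = ?f"
    unfolding annihilate_mode_def by (intro coeff_Abs_poly[of "degree v"]) blast
  with assms show ?thesis by simp
qed

lemma poly_eqI_set_encode: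
  assumes "\<And>X. finite X \<Longrightarrow> coeff v (set_encode X) = coeff w (set_encode X)"
  shows "v = w"
proof (rule poly_eqI)
  fix c show "coeff v c = coeff w c"
    using assms[of "set_decode c"] by simp
qed

lemmas coeff_modes = coeff_create_mode coeff_annihilate_mode

lemma mode_sign_remove:
  assumes "finite X" "a \<in> X"
  shows "mode_sign b (X - {a}) = (if mode_less b a then - mode_sign b X else mode_sign b X)"
  using mode_sign_insert[of "X - {a}" a b] assms by (auto simp: insert_absorb split: if_splits)

lemma anticomm_create_create: "create_mode a (create_mode b v) + create_mode b (create_mode a v) = 0"
proof (rule poly_eqI_set_encode)
  fix X :: "nat set" assume "finite X"
  then show "coeff (create_mode a (create_mode b v) + create_mode b (create_mode a v)) (set_encode X)
      = coeff 0 (set_encode X)"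
    using mode_less_total[of a b] unfolding coeff_add
    by (cases "a = b") (auto simp: coeff_modes mode_sign_remove Diff_insert2[symmetric] insert_commute)
qed

lemma anticomm_annihilate_annihilate:
  "annihilate_mode a (annihilate_mode b v) + annihilate_mode b (annihilate_mode a v) = 0"
proof (rule poly_eqI_set_encode)
  fix X :: "nat set" assume "finite X"
  then show "coeff (annihilate_mode a (annihilate_mode b v) + annihilate_mode b (annihilate_mode a v))
      (set_encode X) = coeff 0 (set_encode X)"
    using mode_less_total[of a b] unfolding coeff_add
    by (cases "a = b")
      (auto simp: coeff_modes mode_sign_insert insert_commute simp del: set_encode_insert)
qed

lemma anticomm_annihilate_create:
  "annihilate_mode a (create_mode b v) + create_mode b (annihilate_mode a v) = (if a = b then v else 0)"
proof (rule poly_eqI_set_encode)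
  fix X :: "nat set" assume X: "finite X"
  have sq: "mode_sign a X * (mode_sign a X * z) = z" for z
    by (simp flip: mult.assoc)
  show "coeff (annihilate_mode a (create_mode b v) + create_mode b (annihilate_mode a v)) (set_encode X)
      = coeff (if a = b then v else 0) (set_encode X)"
  proof (cases "a = b")
    case True
    with X show ?thesis
      by (auto simp: coeff_modes mode_sign_insert mode_sign_remove sq insert_absorb simp del: set_encode_insert)
  next
    case False
    then have "insert a X - {b} = insert a (X - {b})" by auto
    with False X mode_less_total[of a b] show ?thesis
      by (auto simp: coeff_modes mode_sign_insert mode_sign_remove simp del: set_encode_insert)
  qed
qed

lemma anticomm_create_annihilate:
  "create_mode b (annihilate_mode a v) + annihilate_mode a (create_mode b v) = (if a = b then v else 0)"
  using anticomm_annihilate_create[of a b v] by (simp add: add.commute)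

lemma vector_space_smult: "vector_space (smult :: complex \<Rightarrow> complex poly \<Rightarrow> complex poly)"
  by unfold_locales (auto simp: smult_add_right smult_add_left)

lemma linear_create_mode: "Vector_Spaces.linear smult smult (create_mode a)"
  unfolding Vector_Spaces.linear_iff
  by (auto intro!: poly_eqI_set_encode vector_space_smult simp: coeff_modes algebra_simps)

lemma linear_annihilate_mode: "Vector_Spaces.linear smult smult (annihilate_mode a)"
  unfolding Vector_Spaces.linear_iff
  by (auto intro!: poly_eqI_set_encode vector_space_smult simp: coeff_modes algebra_simps)

definition occupied :: "nat list \<times> nat list \<Rightarrow> nat set" where
  "occupied = (\<lambda>(ns, ms). (\<lambda>n. 2 * n + 1) ` set ns \<union> (\<lambda>m. 2 * m) ` set ms)"

lemma create_mode_monom: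
  assumes "finite X" "\<And>b. b \<in> X \<Longrightarrow> mode_less b a"
  shows "create_mode a (monom 1 (set_encode X)) = monom 1 (set_encode (insert a X))"
proof (rule poly_eqI_set_encode)
  fix Y :: "nat set" assume Y: "finite Y"
  have aX: "a \<notin> X" using assms(2)[of a] by auto
  have "\<not> mode_less a b" if "b \<in> insert a X" for b
    using that assms(2)[of b] mode_less_total[of a b] by (cases "a = b") auto
  then have "{b \<in> insert a X. mode_less a b} = {}"
    by blast
  then have "mode_sign a (insert a X) = 1"
    by (simp add: mode_sign_def del: Collect_empty_eq)
  moreover have "X = Y - {a} \<longleftrightarrow> insert a X = Y" if "a \<in> Y"
    using that aX by auto
  ultimately show "coeff (create_mode a (monom 1 (set_encode X))) (set_encode Y) =
      coeff (monom 1 (set_encode (insert a X))) (set_encode Y)"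
    using Y assms(1) by (auto simp: coeff_modes set_encode_eq simp del: set_encode_insert)
qed

lemma fock_monomial_model:
  assumes "s \<in> fock_index"
  shows "fock_monomial model_psi model_psis 1 s = monom 1 (set_encode (occupied s))"
proof -
  obtain ns ms where s: "s = (ns, ms)" by force
  have ms: "foldr (\<lambda>m. model_psis (- int m - 1)) ms 1 =
      monom 1 (set_encode ((\<lambda>m. 2 * m) ` set ms))" if "sorted_wrt (>) ms" for ms
    using that
  proof (induction ms)
    case (Cons m ms)
    then show ?case
      by (auto simp: model_psis_def mode_less_def intro!: create_mode_monom)
  qed auto
  have "foldr (\<lambda>n. model_psi (- int n - 1)) ns (foldr (\<lambda>m. model_psis (- int m - 1)) ms 1) =
      monom 1 (set_encode ((\<lambda>n. 2 * n + 1) ` set ns \<union> (\<lambda>m. 2 * m) ` set ms))"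
    if "sorted_wrt (>) ns" "sorted_wrt (>) ms"
    using that(1)
  proof (induction ns)
    case Nil
    then show ?case using ms that(2) by simp
  next
    case (Cons n ns)
    have "create_mode (Suc (2 * n)) (monom 1 (set_encode
          ((\<lambda>n. Suc (2 * n)) ` set ns \<union> (\<lambda>m. 2 * m) ` set ms))) =
        monom 1 (set_encode (insert (Suc (2 * n))
          ((\<lambda>n. Suc (2 * n)) ` set ns \<union> (\<lambda>m. 2 * m) ` set ms)))"
      using Cons.prems by (intro create_mode_monom) (auto simp: mode_less_def)
    with Cons show ?case
      by (simp add: model_psi_def)
  qed
  with assms show ?thesis
    by (simp add: s fock_monomial_def fock_index_def occupied_def)
qed

lemma sorted_wrt_greater_unique:
  fixes xs ys :: "nat list"
  assumes "sorted_wrt (>) xs" "sorted_wrt (>) ys" "set xs = set ys"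
  shows "xs = ys"
proof -
  have "sorted_wrt (<) (rev xs)" "sorted_wrt (<) (rev ys)"
    using assms by (simp_all add: sorted_wrt_rev)
  then have "rev xs = rev ys"
    using assms(3) by (intro strict_sorted_equal) auto
  then show ?thesis by simp
qed

lemma sorted_wrt_greater_exists:
  fixes X :: "nat set"
  assumes "finite X"
  obtains xs where "sorted_wrt (>) xs" "set xs = X"
  using assms that[of "rev (sorted_list_of_set X)"] by (simp add: sorted_wrt_rev)

lemma inj_on_occupied: "inj_on occupied fock_index"
proof (rule inj_onI)
  fix s t assume st: "s \<in> fock_index" "t \<in> fock_index" "occupied s = occupied t"
  have *: "set (fst s) = {n. 2 * n + 1 \<in> occupied s}" "set (snd s) = {m. 2 * m \<in> occupied s}" for s
    by (auto simp: occupied_def split: prod.splits) presburger+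
  have "set (fst s) = set (fst t)" "set (snd s) = set (snd t)"
    using st(3) by (simp_all add: *)
  with st(1,2) show "s = t"
    by (auto simp: fock_index_def intro!: prod_eqI sorted_wrt_greater_unique split: prod.splits)
qed

lemma occupied_image: "occupied ` fock_index = Collect finite"
proof (intro set_eqI iffI)
  fix X assume "X \<in> Collect (finite :: nat set \<Rightarrow> bool)"
  then have fin: "finite X" by simp
  have "finite {n. 2 * n + 1 \<in> X}" "finite {m. 2 * m \<in> X}"
    using finite_vimageI[OF fin, of "\<lambda>n. 2 * n + 1"] finite_vimageI[OF fin, of "\<lambda>n. 2 * n"]
    by (auto simp: vimage_def inj_on_def)
  then obtain ns ms where nm: "sorted_wrt (>) ns" "set ns = {n. 2 * n + 1 \<in> X}"
      "sorted_wrt (>) ms" "set ms = {m. 2 * m \<in> X}"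
    by (metis sorted_wrt_greater_exists)
  have "occupied (ns, ms) = X"
  proof (rule set_eqI)
    fix x show "x \<in> occupied (ns, ms) \<longleftrightarrow> x \<in> X"
      by (cases "even x") (auto simp: occupied_def nm elim!: evenE oddE)
  qed
  then show "X \<in> occupied ` fock_index"
    using nm by (force simp: fock_index_def)
qed (auto simp: occupied_def)

lemma fock_monomial_model_image:
  "fock_monomial model_psi model_psis 1 ` fock_index = range (monom 1)"
proof -
  have "fock_monomial model_psi model_psis 1 ` fock_index =
      (\<lambda>X. monom 1 (set_encode X)) ` occupied ` fock_index"
    unfolding image_image by (intro image_cong refl fock_monomial_model)
  also have "\<dots> = range (monom 1)"
  proof (intro equalityI subsetI)
    fix v :: "complex poly" assume "v \<in> range (monom 1)"
    then obtain c where "v = monom 1 (set_encode (set_decode c))" by auto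
    then show "v \<in> (\<lambda>X. monom 1 (set_encode X)) ` occupied ` fock_index"
      unfolding occupied_image by (auto intro!: image_eqI[of _ _ "set_decode c"])
  qed auto
  finally show ?thesis .
qed

theorem fermionic_fock_space_model: "fermionic_fock_space smult model_psi model_psis 1"
proof -
  interpret vector_space "smult :: complex \<Rightarrow> complex poly \<Rightarrow> complex poly"
    by (rule vector_space_smult)
  have vac: "annihilate_mode a 1 = 0" for a
  proof (rule poly_eqI_set_encode)
    fix X :: "nat set" assume "finite X"
    then show "coeff (annihilate_mode a 1) (set_encode X) = coeff 0 (set_encode X)"
      by (auto simp: coeff_modes)
  qed
  have indep: "independent (range (monom (1 :: complex)))"
    unfolding dependent_explicit
  proof (intro notI, elim exE conjE bexE)
    fix t :: "complex poly set" and u v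
    assume t: "finite t" "t \<subseteq> range (monom 1)" "(\<Sum>v\<in>t. smult (u v) v) = 0"
      and v: "v \<in> t" "u v \<noteq> 0"
    then obtain i where i: "v = monom 1 i" by auto
    have "0 = coeff (\<Sum>v\<in>t. smult (u v) v) i"
      by (simp add: t(3))
    also have "\<dots> = (\<Sum>v\<in>t. if v = monom 1 i then u v else 0)"
      unfolding coeff_sum using t(2) by (intro sum.cong refl) (auto simp: monom_eq_iff')
    also have "\<dots> = u (monom 1 i)"
      using t(1) v(1) i by simp
    finally show False using v(2) i by simp
  qed
  have span: "span (range (monom (1 :: complex))) = UNIV"
  proof (intro set_eqI iffI UNIV_I)
    fix v :: "complex poly"
    have "v = (\<Sum>i\<le>degree v. smult (coeff v i) (monom 1 i))"
      by (simp add: smult_monom poly_as_sum_of_monoms)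
    also have "\<dots> \<in> span (range (monom 1))"
      by (intro span_sum span_scale span_base rangeI)
    finally show "v \<in> span (range (monom 1))" .
  qed
  have "inj_on (fock_monomial model_psi model_psis 1) fock_index"
  proof (rule inj_onI)
    fix s t assume st: "s \<in> fock_index" "t \<in> fock_index"
      "fock_monomial model_psi model_psis 1 s = fock_monomial model_psi model_psis 1 t"
    have "finite (occupied s)" "finite (occupied t)"
      using st(1,2) occupied_image by blast+
    with st have "occupied s = occupied t"
      by (simp add: fock_monomial_model monom_eq_iff' set_encode_eq)
    with st(1,2) show "s = t"
      using inj_on_occupied by (auto dest: inj_onD)
  qed
  note inj = this
  show ?thesis
  proof (intro fermionic_fock_space.intro fermionic_fock_space_axioms.intro vector_space_smult)
    have parity: "2 * a \<noteq> Suc (2 * b)" for a b :: nat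
      by presburger
    fix k l v
    show "Vector_Spaces.linear smult smult (model_psi k)" "Vector_Spaces.linear smult smult (model_psis k)"
      by (simp_all add: model_psi_def model_psis_def linear_create_mode linear_annihilate_mode)
    show "model_psis l (model_psi k v) + model_psi k (model_psis l v) = (if l + k + 1 = 0 then v else 0)"
      unfolding model_psi_def model_psis_def
      by (auto simp: anticomm_create_create anticomm_annihilate_annihilate
          anticomm_annihilate_create anticomm_create_annihilate)
    show "model_psi l (model_psi k v) + model_psi k (model_psi l v) = 0"
      unfolding model_psi_def
      by (auto simp: parity parity[symmetric] anticomm_create_create anticomm_annihilate_annihilate anticomm_annihilate_create
          anticomm_create_annihilate)
    show "model_psis l (model_psis k v) + model_psis k (model_psis l v) = 0"
      unfolding model_psis_def
      by (auto simp: parity parity[symmetric] anticomm_create_create anticomm_annihilate_annihilate anticomm_annihilate_create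
          anticomm_create_annihilate)
    show "model_psi k 1 = 0" "model_psis k 1 = 0" if "k \<ge> 0"
      using that vac by (simp_all add: model_psi_def model_psis_def)
  qed (simp_all add: inj fock_monomial_model_image indep span)
qed

end

theory Submission
  imports Defs "HOL-Real_Asymp.Real_Asymp"
begin

text \<open>
  For \<open>r \<ge> 0\<close> the coefficient of \<open>t\<^bsup>r + 1/2\<^esup>\<close> in \<open>A(t)\<close> is the number operator of the mode
  created by \<open>\<psi>\<^sup>*(- r - 1/2)\<close>. Hence \<open>b\<^sub>l\<close> counts the partitions of \<open>l\<close>, in Frobenius
  coordinates \<open>(N, M)\<close>, such that \<open>{r\<^sub>1, \<dots>, r\<^sub>n} \<subseteq> N\<close>.

  Call two counts equivalent if they differ by \<open>o(p(l))\<close>. Increasing the largest element of \<open>M\<close>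
  by one shows that every count defined by a condition on \<open>N\<close> alone is increasing in \<open>l\<close>; as
  \<open>p(l + 1) \<sim> p(l)\<close>, such counts are, up to equivalence, invariant under shifts of \<open>l\<close>. Exchanging
  the positions \<open>r\<close> and \<open>r + 1\<close> changes the weight by one, so up to equivalence only the number of
  prescribed elements of \<open>N\<close> matters. Finally, emptying the position \<open>r\<close> and shifting the Maya
  diagram by one restores charge zero and turns the condition \<open>r \<in> N\<close> into \<open>r + 1 \<notin> N\<close>. Hence each
  prescribed element halves the count.

  That \<open>p(l + 1) \<sim> p(l)\<close> means that few partitions have no part equal to one: such a
  partition with \<open>T\<close> distinct part sizes yields \<open>T\<close> partitions of the same number, by trading one
  part \<open>v\<close> for \<open>v\<close> ones, and partitions with a bounded number of part sizes are polynomially few.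
\<close>

section \<open>Frobenius coordinates\<close>

text \<open>For two sets of equal size the half-integral weights \<open>n + 1/2\<close> add up to
  the two sums plus one per pair, whence the summand \<open>card N\<close>. The condition sees
  \<open>N\<close> alone, so that \<open>M\<close> can be changed freely.\<close>

definition frobenius :: "(nat set \<Rightarrow> bool) \<Rightarrow> nat \<Rightarrow> (nat set \<times> nat set) set" where
  "frobenius Q l = {(N, M). finite N \<and> finite M \<and> card N = card M \<and>
     \<Sum>N + \<Sum>M + card N = l \<and> Q N}"

lemma finite_frobenius: "finite (frobenius Q l)"
proof (rule finite_subset)
  show "frobenius Q l \<subseteq> Pow {..l} \<times> Pow {..l}"
  proof clarify
    fix N M assume *: "(N, M) \<in> frobenius Q l"
    have "x \<le> l" if "x \<in> N" for x
      using * that member_le_sum[of x N "\<lambda>x. x"] by (auto simp: frobenius_def)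
    moreover have "x \<le> l" if "x \<in> M" for x
      using * that member_le_sum[of x M "\<lambda>x. x"] by (auto simp: frobenius_def)
    ultimately show "N \<in> Pow {..l} \<and> M \<in> Pow {..l}" by auto
  qed
qed auto

lemma card_frobenius_split:
  "card (frobenius Q l) = card (frobenius (\<lambda>N. Q N \<and> R N) l) + card (frobenius (\<lambda>N. Q N \<and> \<not> R N) l)"
proof -
  have "frobenius Q l = frobenius (\<lambda>N. Q N \<and> R N) l \<union> frobenius (\<lambda>N. Q N \<and> \<not> R N) l"
    by (auto simp: frobenius_def)
  moreover have "frobenius (\<lambda>N. Q N \<and> R N) l \<inter> frobenius (\<lambda>N. Q N \<and> \<not> R N) l = {}"
    by (auto simp: frobenius_def)
  ultimately show ?thesis
    by (simp add: card_Un_disjoint finite_frobenius)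
qed

text \<open>The old maximum of \<open>M\<close> is recovered by lowering the new one, so raising it
  is injective. Positivity of \<open>l\<close> excludes the empty pair, which has no maximum to
  raise.\<close>

lemma card_frobenius_Suc_ge:
  assumes "l > 0"
  shows "card (frobenius Q l) \<le> card (frobenius Q (Suc l))"
proof (rule card_inj_on_le)
  let ?f = "\<lambda>(N :: nat set, M). (N, insert (Suc (Max M)) (M - {Max M}))"
  have ne: "finite M \<and> M \<noteq> {}" if "(N, M) \<in> frobenius Q l" for N M
    using that assms by (auto simp: frobenius_def)
  have Max: "Max (insert (Suc (Max M)) (M - {Max M})) = Suc (Max M)"
    if "finite M" "M \<noteq> {}" for M :: "nat set"
    using that by (intro Max_eqI) (auto simp: le_SucI)
  have inv: "insert (Max M' - 1) (M' - {Max M'}) = M"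
    if "finite M" "M \<noteq> {}" "M' = insert (Suc (Max M)) (M - {Max M})" for M M' :: "nat set"
  proof -
    have "Suc (Max M) \<notin> M" using that(1) Max_ge[of M "Suc (Max M)"] by (metis not_less_eq_eq order_refl)
    then show ?thesis using that(3) Max[OF that(1,2)] Max_in[OF that(1,2)] by auto
  qed
  show "inj_on ?f (frobenius Q l)"
  proof (rule inj_onI, clarify)
    fix N M N' M'
    assume "(N, M) \<in> frobenius Q l" "(N', M') \<in> frobenius Q l"
      "insert (Suc (Max M)) (M - {Max M}) = insert (Suc (Max M')) (M' - {Max M'})"
    then show "N = N \<and> M = M'" using inv[of M] inv[of M'] ne by metis
  qed
  show "?f ` frobenius Q l \<subseteq> frobenius Q (Suc l)"
  proof clarify
    fix N M assume *: "(N, M) \<in> frobenius Q l"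
    have M: "finite M" "M \<noteq> {}" using ne[OF *] by auto
    have nM: "Suc (Max M) \<notin> M" using M(1) Max_ge[of M "Suc (Max M)"] by (metis not_less_eq_eq order_refl)
    have "card (insert (Suc (Max M)) (M - {Max M})) = card M"
      using M nM card.remove[of M "Max M"] by simp
    moreover have "\<Sum>(insert (Suc (Max M)) (M - {Max M})) = Suc (\<Sum>M)"
      using M nM sum.remove[of M "Max M" "\<lambda>x. x"] by simp
    ultimately show "(N, insert (Suc (Max M)) (M - {Max M})) \<in> frobenius Q (Suc l)"
      using * by (auto simp: frobenius_def)
  qed
qed (rule finite_frobenius)

text \<open>Bookkeeping for the shift of a Maya diagram: moving down by one drops \<open>0\<close>
  if present and lowers every other element by one.\<close>

lemma
  fixes M :: "nat set"
  assumes "finite M"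
  shows card_vimage_Suc: "card M = card (Suc -` M) + (if 0 \<in> M then 1 else 0)"
    and sum_vimage_Suc: "\<Sum>M = \<Sum>(Suc -` M) + card (Suc -` M)"
proof -
  define K where "K = Suc -` M"
  have fin: "finite K" using assms by (simp add: K_def finite_vimageI)
  have M: "M = insert 0 (Suc ` K)" if "0 \<in> M"
  proof (rule set_eqI)
    fix x show "x \<in> M \<longleftrightarrow> x \<in> insert 0 (Suc ` K)"
      using that by (cases x) (auto simp: K_def)
  qed
  have M': "M = Suc ` K" if "0 \<notin> M"
  proof (rule set_eqI)
    fix x show "x \<in> M \<longleftrightarrow> x \<in> Suc ` K"
      using that by (cases x) (auto simp: K_def)
  qed
  have card: "card (insert 0 (Suc ` K)) = Suc (card K)" "card (Suc ` K) = card K"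
    and sum: "\<Sum>(insert 0 (Suc ` K)) = \<Sum>K + card K" "\<Sum>(Suc ` K) = \<Sum>K + card K"
    using fin by (simp_all add: card_image sum.reindex sum_Suc)
  have "card M = card K + (if 0 \<in> M then 1 else 0)"
    using card M M' by (metis Suc_eq_plus1 add.right_neutral)
  moreover have "\<Sum>M = \<Sum>K + card K"
    using sum M M' by metis
  ultimately show "card M = card (Suc -` M) + (if 0 \<in> M then 1 else 0)"
    "\<Sum>M = \<Sum>(Suc -` M) + card (Suc -` M)"
    by (simp_all add: K_def)
qed

text \<open>In the Maya diagram \<open>N\<close> lists the occupied positions on one side of the
  boundary and \<open>M\<close> the empty ones on the other. Emptying \<open>r\<close> lowers the
  charge by one and the shift restores it; \<open>N\<close> moves up, \<open>M\<close> moves down,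
  and the weight drops by \<open>r + 1\<close> in total.\<close>

lemma card_frobenius_toggle:
  "card (frobenius (\<lambda>N. r \<in> N \<and> Q (N - {r})) (l + r + 1)) =
   card (frobenius (\<lambda>N. Suc r \<notin> N \<and> Q (Suc -` N)) l)"
    (is "card ?A = card ?B")
proof (rule bij_betw_same_card)
  \<comment> \<open>The position that crosses the boundary arrives at \<open>0\<close>; it is
    occupied exactly if it was not a hole, that is, if \<open>0\<close> is not in \<open>Y\<close>.
    The inverse map exchanges the roles of particles and holes.\<close>
  define up where "up X Y = Suc ` X \<union> (if 0 \<in> Y then {} else {0})" for X Y :: "nat set"
  have up: "Suc -` up X Y = X" "0 \<in> up X Y \<longleftrightarrow> 0 \<notin> Y" "Suc r \<in> up X Y \<longleftrightarrow> r \<in> X"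
    "finite X \<Longrightarrow> finite (up X Y)" for X Y
    by (auto simp: up_def)
  have up_vimage: "up (Suc -` X) Y = X" if "0 \<in> X \<longleftrightarrow> 0 \<notin> Y" for X Y
  proof (rule set_eqI)
    fix x show "x \<in> up (Suc -` X) Y \<longleftrightarrow> x \<in> X"
      using that by (cases x) (auto simp: up_def)
  qed
  let ?f = "\<lambda>(N, M). (up (N - {r}) M, Suc -` M)"
  let ?g = "\<lambda>(N, M). (insert r (Suc -` N), up M N)"
  show "bij_betw ?f ?A ?B"
  proof (rule bij_betw_byWitness[where f' = ?g])
    show "\<forall>a\<in>?A. ?g (?f a) = a"
      by (auto simp: frobenius_def up up_vimage)
    show "\<forall>a\<in>?B. ?f (?g a) = a"
      by (auto simp: frobenius_def up up_vimage)
    show "?f ` ?A \<subseteq> ?B"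
    proof clarify
      fix N M assume "(N, M) \<in> ?A"
      then have *: "finite N" "finite M" "card N = card M" "\<Sum>N + \<Sum>M + card N = l + r + 1" "r \<in> N"
        "Q (N - {r})" by (auto simp: frobenius_def)
      define N' where "N' = up (N - {r}) M"
      have N': "finite N'" "Suc -` N' = N - {r}" "0 \<in> N' \<longleftrightarrow> 0 \<notin> M" "Suc r \<notin> N'"
        using * by (auto simp: N'_def up)
      have "card N = Suc (card (N - {r}))" "\<Sum>N = r + \<Sum>(N - {r})"
        using card.remove[OF *(1,5)] sum.remove[OF *(1,5), of "\<lambda>x. x"] by auto
      then have "card N' = card (Suc -` M)" "\<Sum>N' + \<Sum>(Suc -` M) + card N' = l"
        using *(3,4) N'(3) card_vimage_Suc[OF *(2)] sum_vimage_Suc[OF *(2)]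
          card_vimage_Suc[OF N'(1)] sum_vimage_Suc[OF N'(1)] unfolding N'(2)
        by (auto split: if_splits)
      then show "(up (N - {r}) M, Suc -` M) \<in> ?B"
        unfolding N'_def[symmetric] frobenius_def
        using *(2,6) N' by (auto simp: finite_vimageI)
    qed
    show "?g ` ?B \<subseteq> ?A"
    proof clarify
      fix N M assume "(N, M) \<in> ?B"
      then have *: "finite N" "finite M" "card N = card M" "\<Sum>N + \<Sum>M + card N = l" "Suc r \<notin> N"
        "Q (Suc -` N)" by (auto simp: frobenius_def)
      define M' where "M' = up M N"
      have M': "finite M'" "Suc -` M' = M" "0 \<in> M' \<longleftrightarrow> 0 \<notin> N"
        using * by (auto simp: M'_def up)
      define K where "K = Suc -` N"
      have r: "finite K" "r \<notin> K" using * by (auto simp: finite_vimageI K_def)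
      have "card M' = card (insert r K)" "\<Sum>(insert r K) + \<Sum>M' + card (insert r K) = l + r + 1"
        using *(3,4) M'(3) r card_vimage_Suc[OF *(1)] sum_vimage_Suc[OF *(1)]
          card_vimage_Suc[OF M'(1)] sum_vimage_Suc[OF M'(1)] unfolding M'(2) K_def[symmetric]
        by (auto split: if_splits)
      then show "(insert r (Suc -` N), up M N) \<in> ?A"
        unfolding M'_def[symmetric] frobenius_def
        using *(6) r M'(1) unfolding K_def by auto
    qed
  qed
qed

text \<open>The hypotheses say that \<open>Q\<close> does not see the positions \<open>r\<close> and
  \<open>Suc r\<close>, so moving an element from one to the other preserves \<open>Q\<close> and
  changes only the sum of \<open>N\<close>, by one.\<close>

lemma card_frobenius_swap:
  assumes "\<And>N. Q (insert r N) \<longleftrightarrow> Q N" "\<And>N. Q (insert (Suc r) N) \<longleftrightarrow> Q N"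
  shows "card (frobenius (\<lambda>N. Q N \<and> r \<in> N \<and> Suc r \<notin> N) l) =
    card (frobenius (\<lambda>N. Q N \<and> Suc r \<in> N \<and> r \<notin> N) (Suc l))"
proof (rule bij_betw_same_card)
  have Q: "Q (N - {r}) \<longleftrightarrow> Q N" "Q (N - {Suc r}) \<longleftrightarrow> Q N" for N
    using assms by (metis insert_Diff_single)+
  let ?f = "\<lambda>(N, M :: nat set). (insert (Suc r) (N - {r}), M)"
  let ?g = "\<lambda>(N, M :: nat set). (insert r (N - {Suc r}), M)"
  show "bij_betw ?f (frobenius (\<lambda>N. Q N \<and> r \<in> N \<and> Suc r \<notin> N) l)
      (frobenius (\<lambda>N. Q N \<and> Suc r \<in> N \<and> r \<notin> N) (Suc l))"
  proof (rule bij_betw_byWitness[where f' = ?g])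
    show "?f ` frobenius (\<lambda>N. Q N \<and> r \<in> N \<and> Suc r \<notin> N) l \<subseteq>
        frobenius (\<lambda>N. Q N \<and> Suc r \<in> N \<and> r \<notin> N) (Suc l)"
    proof clarify
      fix N M assume *: "(N, M) \<in> frobenius (\<lambda>N. Q N \<and> r \<in> N \<and> Suc r \<notin> N) l"
      then show "(insert (Suc r) (N - {r}), M) \<in> frobenius (\<lambda>N. Q N \<and> Suc r \<in> N \<and> r \<notin> N) (Suc l)"
        using card.remove[of N r] sum.remove[of N r "\<lambda>x. x"]
        by (auto simp: frobenius_def assms Q)
    qed
    show "?g ` frobenius (\<lambda>N. Q N \<and> Suc r \<in> N \<and> r \<notin> N) (Suc l) \<subseteq>
        frobenius (\<lambda>N. Q N \<and> r \<in> N \<and> Suc r \<notin> N) l"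
    proof clarify
      fix N M assume *: "(N, M) \<in> frobenius (\<lambda>N. Q N \<and> Suc r \<in> N \<and> r \<notin> N) (Suc l)"
      then show "(insert r (N - {Suc r}), M) \<in> frobenius (\<lambda>N. Q N \<and> r \<in> N \<and> Suc r \<notin> N) l"
        using card.remove[of N "Suc r"] sum.remove[of N "Suc r" "\<lambda>x. x"]
        by (auto simp: frobenius_def assms Q)
    qed
  qed (auto simp: frobenius_def)
qed

section \<open>Partitions\<close>

definition partitions :: "nat \<Rightarrow> nat multiset set" where
  "partitions l = {P. 0 \<notin># P \<and> \<Sum>\<^sub># P = l}"

lemma num_partitions_eq: "num_partitions l = card (partitions l)"
  by (simp add: num_partitions_def partitions_def)

section \<open>Partitions with few part sizes and partitions without ones\<close>

lemma size_le_sum_mset: "0 \<notin># P \<Longrightarrow> size P \<le> \<Sum>\<^sub># P" for P :: "nat multiset"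
  by (induction P) auto

text \<open>Induction on \<open>T\<close>: splitting off all copies of one part \<open>v\<close>
  leaves one size fewer, and the pair of \<open>v\<close> and its multiplicity has at most
  \<open>Suc l ^ 2\<close> values. The sum is only bounded by \<open>l\<close>, since splitting off
  lowers it.\<close>

lemma partitions_few_parts:
  fixes l T :: nat
  defines "E \<equiv> \<lambda>T. {P :: nat multiset. 0 \<notin># P \<and> \<Sum>\<^sub># P \<le> l \<and> card (set_mset P) \<le> T}"
  shows "finite (E T)" and "card (E T) \<le> (Suc l ^ 2) ^ T"
proof -
  have "finite (E T) \<and> card (E T) \<le> (Suc l ^ 2) ^ T"
  proof (induction T)
    case 0
    have "E 0 = {{#}}" by (auto simp: E_def)
    then show ?case by simp
  next
    case (Suc T)
    define f where "f = (\<lambda>(P, v :: nat, m). P + replicate_mset m v)"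
    have "E (Suc T) \<subseteq> f ` (E T \<times> {..l} \<times> {..l})"
    proof
      fix Q assume Q: "Q \<in> E (Suc T)"
      show "Q \<in> f ` (E T \<times> {..l} \<times> {..l})"
      proof (cases "Q = {#}")
        case True
        then have "Q = f ({#}, 0, 0)" "{#} \<in> E T" by (auto simp: f_def E_def)
        then show ?thesis by blast
      next
        case False
        then obtain v where v: "v \<in># Q" by blast
        define P where "P = filter_mset (\<lambda>x. x \<noteq> v) Q"
        have QP: "Q = P + replicate_mset (count Q v) v"
          unfolding P_def by (rule multiset_eqI) auto
        have "\<Sum>\<^sub># P \<le> \<Sum>\<^sub># Q"
          using arg_cong[OF QP, of sum_mset] by simp
        moreover have "set_mset P = set_mset Q - {v}" by (auto simp: P_def)
        ultimately have "P \<in> E T"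
          using Q v card_Suc_Diff1[of "set_mset Q" v] by (auto simp: E_def)
        moreover have "v \<le> l"
          using Q v sum_mset.remove[of v Q] by (auto simp: E_def)
        moreover have "count Q v \<le> l"
          using Q size_le_sum_mset[of Q] count_le_size[of Q v] by (auto simp: E_def)
        moreover have "Q = f (P, v, count Q v)" unfolding f_def prod.case by (rule QP)
        ultimately show ?thesis by blast
      qed
    qed
    moreover have "finite (E T \<times> {..l} \<times> {..l})" using Suc by auto
    ultimately have "finite (E (Suc T))" "card (E (Suc T)) \<le> card (E T \<times> {..l} \<times> {..l})"
      by (auto intro: finite_subset surj_card_le)
    moreover have "card (E T \<times> {..l} \<times> {..l}) \<le> (Suc l ^ 2) ^ Suc T"
    proof -
      have "card (E T \<times> {..l} \<times> {..l}) = Suc l ^ 2 * card (E T)"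
        by (simp add: card_cartesian_product power2_eq_square)
      also have "\<dots> \<le> Suc l ^ 2 * (Suc l ^ 2) ^ T"
        using Suc by (intro mult_le_mono2) auto
      finally show ?thesis by simp
    qed
    ultimately show ?case by (meson le_trans)
  qed
  then show "finite (E T)" "card (E T) \<le> (Suc l ^ 2) ^ T" by auto
qed

lemma finite_partitions: "finite (partitions l)"
proof (rule finite_subset)
  show "partitions l \<subseteq> {P. 0 \<notin># P \<and> \<Sum>\<^sub># P \<le> l \<and> card (set_mset P) \<le> l}"
  proof clarify
    fix P assume P: "P \<in> partitions l"
    have "card (set_mset P) \<le> size P"
      unfolding size_multiset_overloaded_eq
      using sum_mono[of "set_mset P" "\<lambda>_. 1" "count P"] by (auto simp: Suc_le_eq)
    with P size_le_sum_mset[of P]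
    show "0 \<notin># P \<and> \<Sum>\<^sub># P \<le> l \<and> card (set_mset P) \<le> l"
      by (auto simp: partitions_def)
  qed
qed (rule partitions_few_parts)

text \<open>Removing a part one identifies the partitions of \<open>Suc l\<close> containing a one
  with those of \<open>l\<close>. Thus the partitions without ones measure the increment of the
  partition function.\<close>

lemma card_partitions_Suc:
  "card (partitions (Suc l)) = card (partitions l) + card {P \<in> partitions (Suc l). 1 \<notin># P}"
proof -
  have "partitions (Suc l) = add_mset 1 ` partitions l \<union> {P \<in> partitions (Suc l). 1 \<notin># P}"
  proof (intro equalityI subsetI)
    fix P assume P: "P \<in> partitions (Suc l)"
    show "P \<in> add_mset 1 ` partitions l \<union> {P \<in> partitions (Suc l). 1 \<notin># P}"
    proof (cases "1 \<in># P")
      case True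
      then obtain R where "P = add_mset 1 R" by (metis mset_add)
      with P show ?thesis by (auto simp: partitions_def)
    qed (use P in auto)
  qed (auto simp: partitions_def)
  also have "card \<dots> = card (add_mset 1 ` partitions l) + card {P \<in> partitions (Suc l). 1 \<notin># P}"
    by (intro card_Un_disjoint) (auto simp: finite_partitions)
  also have "card (add_mset 1 ` partitions l) = card (partitions l)"
    by (intro card_image inj_onI) auto
  finally show ?thesis .
qed

text \<open>Trading a part \<open>v\<close> for \<open>v\<close> ones is reversible, \<open>v\<close> being the number of ones obtained.\<close>

lemma sum_distinct_parts_le:
  "(\<Sum>P | P \<in> partitions l \<and> 1 \<notin># P. card (set_mset P)) \<le> card (partitions l)"
proof -
  let ?A = "Sigma {P \<in> partitions l. 1 \<notin># P} set_mset"
  let ?f = "\<lambda>(P :: nat multiset, v). (P - {#v#}) + replicate_mset v 1"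
  have "inj_on ?f ?A"
  proof (rule inj_onI, clarify)
    fix P v P' v'
    assume *: "P \<in> partitions l" "1 \<notin># P" "P' \<in> partitions l" "1 \<notin># P'" "v \<in># P" "v' \<in># P'"
      and eq: "P - {#v#} + replicate_mset v 1 = P' - {#v'#} + replicate_mset v' 1"
    have "1 \<notin># P - {#v#}" "1 \<notin># P' - {#v'#}"
      using * in_diffD by metis+
    then have "count (P - {#v#}) 1 = 0" "count (P' - {#v'#}) 1 = 0"
      by (metis count_eq_zero_iff)+
    then have v: "v = v'"
      using arg_cong[OF eq, of "\<lambda>M. count M 1"] by simp
    with eq have "P - {#v#} = P' - {#v#}" by simp
    with * v have "P = P'" by (metis insert_DiffM)
    with v show "P = P' \<and> v = v'" by simp
  qed
  moreover have "?f ` ?A \<subseteq> partitions l"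
  proof clarify
    fix P v assume P: "P \<in> partitions l" "v \<in># P"
    then obtain R where "P = add_mset v R" by (metis mset_add)
    with P show "P - {#v#} + replicate_mset v 1 \<in> partitions l"
      by (auto simp: partitions_def)
  qed
  ultimately have "card ?A \<le> card (partitions l)"
    by (intro card_inj_on_le[of ?f]) (auto simp: finite_partitions)
  then show ?thesis
    by (simp add: card_SigmaI finite_partitions)
qed

text \<open>Partitions with more than \<open>T\<close> sizes are counted at least \<open>T\<close>
  times in \<open>sum_distinct_parts_le\<close>; the remaining ones fall under the polynomial bound
  of \<open>partitions_few_parts\<close>.\<close>

lemma card_partitions_no_ones_le:
  "T * card {P \<in> partitions l. 1 \<notin># P} \<le> card (partitions l) + T * (Suc l ^ 2) ^ T"
proof -
  let ?A = "{P \<in> partitions l. 1 \<notin># P}"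
  let ?E = "{P. 0 \<notin># P \<and> \<Sum>\<^sub># P \<le> l \<and> card (set_mset P) \<le> T}"
  have fin: "finite ?A" by (simp add: finite_partitions)
  have "T * card (?A - ?E) \<le> (\<Sum>P\<in>?A - ?E. card (set_mset P))"
    using sum_bounded_below[of "?A - ?E" T "\<lambda>P. card (set_mset P)"]
    by (force simp: partitions_def mult.commute)
  also have "\<dots> \<le> (\<Sum>P\<in>?A. card (set_mset P))"
    using fin by (intro sum_mono2) auto
  also have "\<dots> \<le> card (partitions l)"
    by (rule sum_distinct_parts_le)
  finally have 1: "T * card (?A - ?E) \<le> card (partitions l)" .
  have "card ?A \<le> card ((?A - ?E) \<union> ?E)"
    using fin partitions_few_parts(1)[of l T] by (intro card_mono) auto
  also have "\<dots> \<le> card (?A - ?E) + (Suc l ^ 2) ^ T"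
    using card_Un_le[of "?A - ?E" ?E] partitions_few_parts(2)[of l T] by linarith
  finally have "T * card ?A \<le> T * (card (?A - ?E) + (Suc l ^ 2) ^ T)"
    by (rule mult_le_mono2)
  with 1 show ?thesis by (simp add: algebra_simps)
qed

section \<open>Superpolynomial growth of the number of partitions\<close>

lemma card_partitions_ge:
  assumes "Suc K ^ 2 \<le> l"
  shows "2 ^ K \<le> card (partitions l)"
proof -
  \<comment> \<open>A set of parts from \<open>2\<close> to \<open>Suc K\<close> is padded with
    ones. Starting at two keeps it apart from the padding, so it can be read off from the partition;
    its sum is at most \<open>K * Suc K\<close>, which fits into \<open>l\<close>.\<close>
  let ?f = "\<lambda>S. mset_set S + replicate_mset (l - \<Sum>S) 1"
  have S: "finite S \<and> 0 \<notin> S \<and> 1 \<notin> S \<and> \<Sum>S \<le> l" if "S \<in> Pow {2..Suc K}" for S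
  proof -
    have "\<Sum>S \<le> \<Sum>{2..Suc K}" using that by (intro sum_mono2) auto
    also have "\<dots> \<le> K * Suc K"
      using sum_bounded_above[of "{2..Suc K}" "\<lambda>x. x" "Suc K"] by simp
    also have "\<dots> \<le> l" using assms by (simp add: power2_eq_square)
    finally show ?thesis using that finite_subset[of S "{2..Suc K}"] by auto
  qed
  have "inj_on ?f (Pow {2..Suc K})"
  proof (rule inj_onI)
    fix S S' assume SS: "S \<in> Pow {2..Suc K}" "S' \<in> Pow {2..Suc K}" and eq: "?f S = ?f S'"
    have "set_mset (?f S) - {1} = S" if "S \<in> Pow {2..Suc K}" for S
      using S[OF that] by auto
    then show "S = S'" using SS eq by metis
  qed
  moreover have "?f ` Pow {2..Suc K} \<subseteq> partitions l"
  proof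
    fix P assume "P \<in> ?f ` Pow {2..Suc K}"
    then obtain S where "S \<in> Pow {2..Suc K}" "P = ?f S" by blast
    with S[of S] show "P \<in> partitions l"
      by (auto simp: partitions_def sum_unfold_sum_mset)
  qed
  ultimately have "card (Pow {2..Suc K}) \<le> card (partitions l)"
    by (intro card_inj_on_le[of ?f]) (auto simp: finite_partitions)
  then show ?thesis by (simp add: card_Pow)
qed

lemma card_partitions_pos: "card (partitions l) > 0"
proof -
  have "replicate_mset l 1 \<in> partitions l" by (auto simp: partitions_def)
  then show ?thesis using finite_partitions card_gt_0_iff by blast
qed

lemma partitions_superpolynomial:
  "(\<lambda>l. (real (Suc l) ^ 2) ^ T / card (partitions l)) \<longlonglongrightarrow> 0"
proof (rule tendsto_sandwich[of "\<lambda>_. 0"])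
  show "(\<lambda>l. (real (Suc l) ^ 2) ^ T / 2 powr (sqrt l - 2)) \<longlonglongrightarrow> 0"
    by real_asymp
  show "\<forall>\<^sub>F l in sequentially. (real (Suc l) ^ 2) ^ T / card (partitions l)
      \<le> (real (Suc l) ^ 2) ^ T / 2 powr (sqrt l - 2)"
    using eventually_ge_at_top[of 1]
  proof eventually_elim
    case (elim l)
    \<comment> \<open>The largest \<open>K\<close> with \<open>Suc K ^ 2 \<le> l\<close>. Rounding
      and the subtracted one cost at most two in the exponent.\<close>
    define K where "K = nat \<lfloor>sqrt l\<rfloor> - 1"
    have "sqrt l \<ge> 1" using elim by simp
    then have K: "real (Suc K) \<le> sqrt l" "sqrt l - 2 \<le> K"
      unfolding K_def by linarith+
    then have "real (Suc K) ^ 2 \<le> sqrt l ^ 2" by (intro power_mono) auto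
    then have "real (Suc K ^ 2) \<le> real l" by simp
    then have "2 ^ K \<le> card (partitions l)"
      by (intro card_partitions_ge) (simp only: of_nat_le_iff)
    then have "real (2 ^ K) \<le> card (partitions l)" by (simp only: of_nat_le_iff)
    moreover have "2 powr (sqrt l - 2) \<le> 2 powr real K"
      using K(2) by (intro powr_mono) auto
    moreover have "2 powr real K = real (2 ^ K)" by (simp add: powr_realpow)
    ultimately have "2 powr (sqrt l - 2) \<le> card (partitions l)" by linarith
    then show ?case by (intro divide_left_mono) (auto simp: card_partitions_pos)
  qed
qed auto

lemma partitions_no_ones_negligible:
  "(\<lambda>l. card {P \<in> partitions l. 1 \<notin># P} / card (partitions l)) \<longlonglongrightarrow> 0"
proof (rule LIMSEQ_I)
  fix e :: real assume e: "e > 0"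
  \<comment> \<open>One half of \<open>e\<close> pays for \<open>1 / T\<close>; once
    \<open>T\<close> is fixed, the other half pays for the polynomial term for large
    \<open>l\<close>.\<close>
  obtain T :: nat where T: "T > 0" "1 / T < e / 2"
    using e by (metis half_gt_zero nat_approx_posE zero_less_Suc inverse_eq_divide)
  obtain L where L: "\<And>l. l \<ge> L \<Longrightarrow> (real (Suc l) ^ 2) ^ T / card (partitions l) < e / 2"
    using LIMSEQ_D[OF partitions_superpolynomial[of T], of "e / 2"] e by auto
  show "\<exists>L. \<forall>l\<ge>L. norm (card {P \<in> partitions l. 1 \<notin># P} / card (partitions l) - 0) < e"
  proof (intro exI allI impI)
    fix l assume "l \<ge> L"
    let ?d = "card {P \<in> partitions l. 1 \<notin># P}" and ?p = "card (partitions l)"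
    have "real (T * ?d) \<le> real (?p + T * (Suc l ^ 2) ^ T)"
      using card_partitions_no_ones_le[of T l] by (simp only: of_nat_le_iff)
    then have "real ?d / ?p \<le> 1 / T + (real (Suc l) ^ 2) ^ T / ?p"
      using T(1) card_partitions_pos[of l] by (simp add: field_simps)
    also have "\<dots> < e" using T(2) L[OF \<open>l \<ge> L\<close>] by linarith
    finally show "norm (?d / ?p - 0) < e" by simp
  qed
qed

theorem num_partitions_ratio: "(\<lambda>l. num_partitions l / num_partitions (Suc l)) \<longlonglongrightarrow> 1"
proof -
  have "num_partitions l / num_partitions (Suc l) =
      1 - card {P \<in> partitions (Suc l). 1 \<notin># P} / card (partitions (Suc l))" for l
  proof -
    have "real (card (partitions l)) =
        card (partitions (Suc l)) - real (card {P \<in> partitions (Suc l). 1 \<notin># P})"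
      using card_partitions_Suc[of l] by linarith
    then show ?thesis
      using card_partitions_pos[of "Suc l"] by (simp add: num_partitions_eq diff_divide_distrib)
  qed
  moreover have "(\<lambda>l. 1 - card {P \<in> partitions (Suc l). 1 \<notin># P} / card (partitions (Suc l))) \<longlonglongrightarrow> 1 - 0"
    using LIMSEQ_Suc[OF partitions_no_ones_negligible] by (intro tendsto_intros)
  ultimately show ?thesis by simp
qed

text \<open>No explicit bijection is built: both sides satisfy c(k, l) = c(k - 1, l) + c(k, l - k).
  For partitions the second term removes one part \<open>k\<close>; for Frobenius coordinates it
  empties the position k - 1 by \<open>card_frobenius_toggle\<close>. The bound k on the parts
  corresponds to k - 1 on \<open>N\<close>, as an arm does not include its diagonal cell.\<close>

lemma card_bounded_partitions:
  "card {P \<in> partitions l. set_mset P \<subseteq> {..k}} = card (frobenius (\<lambda>N. N \<subseteq> {..<k}) l)"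
proof (induction "k + l" arbitrary: k l rule: less_induct)
  case less
  show ?case
  proof (cases k)
    case 0
    have "P \<in> partitions l \<and> set_mset P \<subseteq> {..k} \<longleftrightarrow> P = {#} \<and> l = 0" for P
    proof
      assume P: "P \<in> partitions l \<and> set_mset P \<subseteq> {..k}"
      then have "set_mset P = {}" by (auto simp: partitions_def 0)
      with P show "P = {#} \<and> l = 0" by (auto simp: partitions_def)
    qed (auto simp: partitions_def)
    then have "{P \<in> partitions l. set_mset P \<subseteq> {..k}} = (if l = 0 then {{#}} else {})"
      by auto
    moreover have "frobenius (\<lambda>N. N \<subseteq> {..<k}) l = (if l = 0 then {({}, {})} else {})"
      by (auto simp: frobenius_def 0)
    ultimately show ?thesis by simp
  next
    case (Suc j)
    let ?P = "\<lambda>k l. {P \<in> partitions l. set_mset P \<subseteq> {..k}}"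
    have cP: "card (?P k l) = card (?P j l) + card {P \<in> ?P k l. k \<in># P}"
    proof -
      have "card (?P j l \<union> {P \<in> ?P k l. k \<in># P}) = card (?P j l) + card {P \<in> ?P k l. k \<in># P}"
        by (rule card_Un_disjoint) (auto simp: finite_partitions Suc)
      also have "?P j l \<union> {P \<in> ?P k l. k \<in># P} = ?P k l"
        by (auto simp: Suc le_Suc_eq)
      finally show ?thesis .
    qed
    have F: "card (frobenius (\<lambda>N. N \<subseteq> {..<k}) l) =
        card (frobenius (\<lambda>N. N \<subseteq> {..<j}) l) + card (frobenius (\<lambda>N. j \<in> N \<and> N - {j} \<subseteq> {..<j}) l)"
    proof -
      have "(\<lambda>N. N \<subseteq> {..<k} \<and> j \<in> N) = (\<lambda>N. j \<in> N \<and> N - {j} \<subseteq> {..<j})"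
        "(\<lambda>N. N \<subseteq> {..<k} \<and> j \<notin> N) = (\<lambda>N. N \<subseteq> {..<j})"
        by (auto simp: Suc less_Suc_eq fun_eq_iff)
      then show ?thesis
        using card_frobenius_split[of "\<lambda>N. N \<subseteq> {..<k}" l "\<lambda>N. j \<in> N"] by simp
    qed
    have 1: "card (?P j l) = card (frobenius (\<lambda>N. N \<subseteq> {..<j}) l)"
      by (rule less) (simp add: Suc)
    have 2: "card {P \<in> ?P k l. k \<in># P} = card (frobenius (\<lambda>N. j \<in> N \<and> N - {j} \<subseteq> {..<j}) l)"
    \<comment> \<open>Below weight \<open>k\<close> both sides are empty: an element
      \<open>j\<close> of \<open>N\<close> contributes \<open>j\<close> to the sum and at least one
      through \<open>card N\<close>.\<close>
    proof (cases "l < k")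
      case True
      have "\<not> (P \<in> partitions l \<and> k \<in># P)" for P
        using True sum_mset.remove[of k P] by (auto simp: partitions_def)
      moreover have "\<not> (N, M) \<in> frobenius (\<lambda>N. j \<in> N \<and> N - {j} \<subseteq> {..<j}) l" for N M
      proof
        assume *: "(N, M) \<in> frobenius (\<lambda>N. j \<in> N \<and> N - {j} \<subseteq> {..<j}) l"
        then have "card N > 0" by (auto simp: frobenius_def card_gt_0_iff)
        with * True Suc show False
          using member_le_sum[of j N "\<lambda>x. x"] by (auto simp: frobenius_def)
      qed
      ultimately have e: "{P \<in> ?P k l. k \<in># P} = {}" "frobenius (\<lambda>N. j \<in> N \<and> N - {j} \<subseteq> {..<j}) l = {}"
        by auto
      show ?thesis unfolding e by simp
    next
      case False
      then obtain m where m: "l = m + k" by (metis add.commute le_add_diff_inverse not_less)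
      have "{P \<in> ?P k l. k \<in># P} = add_mset k ` ?P k m"
      proof (intro equalityI subsetI)
        fix P assume P: "P \<in> {P \<in> ?P k l. k \<in># P}"
        then obtain R where "P = add_mset k R" by (metis (mono_tags, lifting) mem_Collect_eq mset_add)
        with P show "P \<in> add_mset k ` ?P k m" by (auto simp: partitions_def m)
      qed (auto simp: partitions_def m Suc)
      then have "card {P \<in> ?P k l. k \<in># P} = card (?P k m)"
        by (simp add: card_image inj_on_def)
      also have "\<dots> = card (frobenius (\<lambda>N. N \<subseteq> {..<k}) m)"
        by (rule less) (simp add: m Suc)
      \<comment> \<open>The condition produced by the toggle is again a bound on \<open>N\<close>:
        its elements are \<open>0\<close> or successors of numbers below \<open>j\<close>.\<close>
      also have "(\<lambda>N. N \<subseteq> {..<k}) = (\<lambda>N. Suc j \<notin> N \<and> Suc -` N \<subseteq> {..<j})"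
      proof (rule ext)
        fix N
        have "N \<subseteq> {..<k}" if *: "Suc j \<notin> N \<and> Suc -` N \<subseteq> {..<j}"
        proof
          fix x assume "x \<in> N"
          with * show "x \<in> {..<k}" by (cases x) (auto simp: Suc)
        qed
        then show "(N \<subseteq> {..<k}) = (Suc j \<notin> N \<and> Suc -` N \<subseteq> {..<j})" by (auto simp: Suc)
      qed
      also have "card (frobenius \<dots> m) = card (frobenius (\<lambda>N. j \<in> N \<and> N - {j} \<subseteq> {..<j}) (m + j + 1))"
        by (rule card_frobenius_toggle[symmetric])
      finally show ?thesis by (simp add: m Suc)
    qed
    show ?thesis using cP F 1 2 by simp
  qed
qed

text \<open>At weight \<open>l\<close> the bound \<open>k = l\<close> excludes nothing on either
  side of \<open>card_bounded_partitions\<close>.\<close>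

theorem num_partitions_eq_card_frobenius: "num_partitions l = card (frobenius (\<lambda>_. True) l)"
proof -
  have "partitions l = {P \<in> partitions l. set_mset P \<subseteq> {..l}}"
  proof -
    have "x \<le> l" if "P \<in> partitions l" "x \<in># P" for P x
      using that sum_mset.remove[of x P] by (auto simp: partitions_def)
    then show ?thesis by auto
  qed
  moreover have "frobenius (\<lambda>_. True) l = frobenius (\<lambda>N. N \<subseteq> {..<l}) l"
  proof -
    have "x < l" if "(N, M) \<in> frobenius (\<lambda>_. True) l" "x \<in> N" for N M x
      using that member_le_sum[of x N "\<lambda>x. x"] card_gt_0_iff[of N] by (auto simp: frobenius_def)
    then show ?thesis by (auto simp: frobenius_def)
  qed
  ultimately show ?thesis
    using card_bounded_partitions[of l l] by (simp add: num_partitions_eq)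
qed

section \<open>Frequencies of prescribed Frobenius coordinates\<close>

lemma num_partitions_pos: "num_partitions l > 0"
  by (simp add: num_partitions_eq card_partitions_pos)

lemma card_frobenius_le: "card (frobenius Q l) \<le> num_partitions l"
  unfolding num_partitions_eq_card_frobenius
  by (intro card_mono finite_frobenius) (auto simp: frobenius_def)

lemma num_partitions_shift: "(\<lambda>l. num_partitions l / num_partitions (l + s)) \<longlonglongrightarrow> 1"
proof (induction s)
  case 0
  then show ?case by (simp add: less_imp_neq[OF num_partitions_pos, symmetric])
next
  case (Suc s)
  have "(\<lambda>l. num_partitions (l + s) / num_partitions (Suc (l + s))) \<longlonglongrightarrow> 1"
    by (rule LIMSEQ_ignore_initial_segment[OF num_partitions_ratio])
  from tendsto_mult[OF Suc this] show ?case
    using num_partitions_pos by simp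
qed

text \<open>Dividing by the partition function turns equality up to o(p(l)) into a difference
  tending to zero.\<close>

definition freq :: "(nat set \<Rightarrow> bool) \<Rightarrow> nat \<Rightarrow> real" where
  "freq Q l = card (frobenius Q l) / num_partitions l"

lemma freq_split: "freq Q l = freq (\<lambda>N. Q N \<and> R N) l + freq (\<lambda>N. Q N \<and> \<not> R N) l"
  unfolding freq_def card_frobenius_split[of Q l R] by (simp add: add_divide_distrib)

text \<open>The counts for \<open>Q\<close> and for its negation both increase with \<open>l\<close>, and they add up to
  \<^const>\<open>num_partitions\<close>, so neither can vary faster than \<^const>\<open>num_partitions\<close>.\<close>

lemma freq_Suc: "(\<lambda>l. freq Q (Suc l) - freq Q l) \<longlonglongrightarrow> 0"
proof (rule Lim_null_comparison)
  show "(\<lambda>l. 2 * (1 - num_partitions l / num_partitions (Suc l))) \<longlonglongrightarrow> 0"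
    using tendsto_mult_left[OF tendsto_diff[OF tendsto_const[of 1] num_partitions_ratio], of 2] by simp
  show "\<forall>\<^sub>F l in sequentially. norm (freq Q (Suc l) - freq Q l)
      \<le> 2 * (1 - num_partitions l / num_partitions (Suc l))"
    using eventually_gt_at_top[of 0]
  proof eventually_elim
    case (elim l)
    define u u' v v' where "u = real (card (frobenius Q l))" and "u' = real (card (frobenius Q (Suc l)))"
      and "v = real (card (frobenius (\<lambda>N. \<not> Q N) l))" and "v' = real (card (frobenius (\<lambda>N. \<not> Q N) (Suc l)))"
    define p p' where "p = real (num_partitions l)" and "p' = real (num_partitions (Suc l))"
    have p: "p = u + v" "p' = u' + v'"
      unfolding p_def p'_def u_def v_def u'_def v'_def num_partitions_eq_card_frobenius
        card_frobenius_split[of "\<lambda>_. True" _ Q] by simp_all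
    have mono: "u \<le> u'" "v \<le> v'"
      unfolding u_def v_def u'_def v'_def using card_frobenius_Suc_ge[OF elim] by simp_all
    have pos: "p > 0" "p' > 0" "0 \<le> u" "u \<le> p"
      unfolding p_def p'_def u_def using card_frobenius_le[of Q l] by (simp_all add: num_partitions_pos)
    \<comment> \<open>The numerator is changed first, then the denominator. Each step costs at most
      \<open>(p' - p) / p'\<close>: the first because \<open>v \<le> v'\<close> bounds
      \<open>u' - u\<close> by \<open>p' - p\<close>, the second because
      \<open>u \<le> p\<close>.\<close>
    have "\<bar>u' / p' - u / p\<bar> \<le> \<bar>(u' - u) / p'\<bar> + \<bar>u / p' - u / p\<bar>"
      by (simp add: diff_divide_distrib)
    also have "\<bar>(u' - u) / p'\<bar> \<le> (p' - p) / p'"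
      using p mono pos by (simp add: divide_right_mono)
    also have "\<bar>u / p' - u / p\<bar> = u / p * ((p' - p) / p')"
    proof -
      have "u / p' \<le> u / p" using p mono pos by (intro divide_left_mono) auto
      moreover have "u / p - u / p' = u / p * ((p' - p) / p')"
        using pos by (simp add: field_simps)
      ultimately show ?thesis by linarith
    qed
    also have "\<dots> \<le> 1 * ((p' - p) / p')"
      using p mono pos by (intro mult_right_mono) auto
    finally show ?case
      using pos unfolding freq_def u_def u'_def p_def p'_def by (simp add: diff_divide_distrib)
  qed
qed

lemma freq_shift: "(\<lambda>l. freq Q (l + s) - freq Q l) \<longlonglongrightarrow> 0"
proof (induction s)
  case (Suc s)
  have "(\<lambda>l. freq Q (Suc (l + s)) - freq Q (l + s)) \<longlonglongrightarrow> 0"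
    by (rule LIMSEQ_ignore_initial_segment[OF freq_Suc])
  from tendsto_add[OF this Suc] show ?case by simp
qed simp

text \<open>Converts an exact identity of counts at shifted weights into asymptotic equality: the
  shift costs the factor p(l) / p(l + s), which tends to one, on a bounded frequency, and
  \<open>freq_shift\<close> removes the shift in \<open>Q\<close>.\<close>

lemma freq_relate:
  assumes "\<And>l. card (frobenius Q (l + s)) = card (frobenius R l)"
  shows "(\<lambda>l. freq Q l - freq R l) \<longlonglongrightarrow> 0"
proof -
  have bdd: "0 \<le> freq R l \<and> freq R l \<le> 1" for l
    by (auto simp: freq_def num_partitions_pos card_frobenius_le divide_le_eq)
  have "(\<lambda>l. num_partitions l / num_partitions (l + s) - 1) \<longlonglongrightarrow> 0"
    using tendsto_diff[OF num_partitions_shift[of s] tendsto_const[of 1]] by simp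
  then have "(\<lambda>l. freq R l * (num_partitions l / num_partitions (l + s) - 1)) \<longlonglongrightarrow> 0"
    by (rule Lim_null_comparison[OF _ tendsto_norm_zero, rotated])
      (use bdd in \<open>auto simp: abs_mult mult_left_le_one_le\<close>)
  moreover have "freq R l * (num_partitions l / num_partitions (l + s) - 1) = freq Q (l + s) - freq R l" for l
    using num_partitions_pos[of l] assms by (simp add: freq_def algebra_simps)
  ultimately have "(\<lambda>l. freq Q (l + s) - freq R l) \<longlonglongrightarrow> 0" by simp
  from tendsto_diff[OF this freq_shift[of Q s]] show ?thesis by simp
qed

text \<open>Sets containing both positions contribute equally to the two frequencies; the others are
  matched by \<open>card_frobenius_swap\<close>, at weights differing by one.\<close>

lemma freq_move:
  assumes "r \<notin> A" "Suc r \<notin> A"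
  shows "(\<lambda>l. freq (\<lambda>N. insert r A \<subseteq> N) l - freq (\<lambda>N. insert (Suc r) A \<subseteq> N) l) \<longlonglongrightarrow> 0"
proof -
  let ?Q = "\<lambda>N. A \<subseteq> N"
  let ?a = "freq (\<lambda>N. ?Q N \<and> r \<in> N \<and> Suc r \<notin> N)" and ?b = "freq (\<lambda>N. ?Q N \<and> Suc r \<in> N \<and> r \<notin> N)"
  have "card (frobenius (\<lambda>N. ?Q N \<and> Suc r \<in> N \<and> r \<notin> N) (l + 1)) =
      card (frobenius (\<lambda>N. ?Q N \<and> r \<in> N \<and> Suc r \<notin> N) l)" for l
    using card_frobenius_swap[of ?Q r l] assms by (simp add: subset_insert)
  then have "(\<lambda>l. ?b l - ?a l) \<longlonglongrightarrow> 0"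
    by (rule freq_relate)
  then have "(\<lambda>l. - (?b l - ?a l)) \<longlonglongrightarrow> - 0" by (rule tendsto_minus)
  moreover have "freq (\<lambda>N. insert r A \<subseteq> N) l - freq (\<lambda>N. insert (Suc r) A \<subseteq> N) l = - (?b l - ?a l)" for l
  proof -
    have "(\<lambda>N. insert r A \<subseteq> N \<and> Suc r \<in> N) = (\<lambda>N. insert (Suc r) A \<subseteq> N \<and> r \<in> N)"
      "(\<lambda>N. insert r A \<subseteq> N \<and> Suc r \<notin> N) = (\<lambda>N. ?Q N \<and> r \<in> N \<and> Suc r \<notin> N)"
      "(\<lambda>N. insert (Suc r) A \<subseteq> N \<and> r \<notin> N) = (\<lambda>N. ?Q N \<and> Suc r \<in> N \<and> r \<notin> N)"
      by auto
    then show ?thesis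
      using freq_split[of "\<lambda>N. insert r A \<subseteq> N" l "\<lambda>N. Suc r \<in> N"]
        freq_split[of "\<lambda>N. insert (Suc r) A \<subseteq> N" l "\<lambda>N. r \<in> N"] by simp
  qed
  ultimately show ?thesis by simp
qed

text \<open>The elements are moved up one at a time, the largest first, so that each target is free.
  The set \<open>B\<close> collects those already moved, and the gap in the hypothesis leaves room
  for the next move.\<close>

lemma freq_image_Suc:
  assumes "finite A" "\<forall>a\<in>A. \<forall>b\<in>B. Suc a < b"
  shows "(\<lambda>l. freq (\<lambda>N. A \<union> B \<subseteq> N) l - freq (\<lambda>N. Suc ` A \<union> B \<subseteq> N) l) \<longlonglongrightarrow> 0"
  using assms
proof (induction A arbitrary: B rule: finite_linorder_max_induct)
  case empty
  then show ?case by simp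
next
  case (insert a A)
  have "a \<notin> A \<union> B" "Suc a \<notin> A \<union> B"
    using insert.hyps insert.prems by fastforce+
  then have "(\<lambda>l. freq (\<lambda>N. insert a (A \<union> B) \<subseteq> N) l - freq (\<lambda>N. insert (Suc a) (A \<union> B) \<subseteq> N) l) \<longlonglongrightarrow> 0"
    by (rule freq_move)
  moreover have "(\<lambda>l. freq (\<lambda>N. A \<union> insert (Suc a) B \<subseteq> N) l - freq (\<lambda>N. Suc ` A \<union> insert (Suc a) B \<subseteq> N) l)
      \<longlonglongrightarrow> 0"
    using insert.hyps insert.prems by (intro insert.IH) auto
  ultimately show ?case
    using tendsto_add by fastforce
qed

text \<open>Write \<open>A\<close> as \<open>A'\<close> with \<open>r\<close> added. By the toggle,
  the frequency of \<open>A\<close> agrees asymptotically with that of containing the shifted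
  \<open>A'\<close> but not \<open>Suc r\<close>; by \<open>freq_image_Suc\<close> it also agrees
  with that of containing the shifted \<open>A'\<close> and \<open>Suc r\<close>. The two add up to
  the frequency of the shifted \<open>A'\<close>, known by induction.\<close>

theorem freq_limit: "finite A \<Longrightarrow> freq (\<lambda>N. A \<subseteq> N) \<longlonglongrightarrow> 1 / 2 ^ card A"
proof (induction "card A" arbitrary: A)
  case 0
  then have "freq (\<lambda>N. A \<subseteq> N) = (\<lambda>l. 1)"
    using num_partitions_pos by (auto simp: freq_def num_partitions_eq_card_frobenius fun_eq_iff)
  then show ?case using 0 by simp
next
  case (Suc n)
  then obtain r A' where A: "A = insert r A'" "r \<notin> A'" "finite A'" "card A' = n"
    by (metis card_Suc_eq_finite)
  let ?F = "\<lambda>A. freq (\<lambda>N. A \<subseteq> N)"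
  let ?U = "freq (\<lambda>N. Suc ` A' \<subseteq> N \<and> Suc r \<notin> N)"
  have "card (frobenius (\<lambda>N. A \<subseteq> N) (l + (r + 1))) =
      card (frobenius (\<lambda>N. Suc ` A' \<subseteq> N \<and> Suc r \<notin> N) l)" for l
  proof -
    have "(\<lambda>N. r \<in> N \<and> A' \<subseteq> N - {r}) = (\<lambda>N. A \<subseteq> N)"
      "(\<lambda>N. Suc r \<notin> N \<and> A' \<subseteq> Suc -` N) = (\<lambda>N. Suc ` A' \<subseteq> N \<and> Suc r \<notin> N)"
      using A by auto
    then show ?thesis using card_frobenius_toggle[of r "\<lambda>N. A' \<subseteq> N" l] by (simp add: add.assoc)
  qed
  then have "(\<lambda>l. ?F A l - ?U l) \<longlonglongrightarrow> 0" by (rule freq_relate)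
  moreover have "(\<lambda>l. ?F A l - ?F (Suc ` A) l) \<longlonglongrightarrow> 0"
    using freq_image_Suc[of A "{}"] A by simp
  moreover have "?F (Suc ` A') \<longlonglongrightarrow> 1 / 2 ^ n"
    using Suc.hyps(1)[of "Suc ` A'"] A by (simp add: card_image)
  ultimately have lim: "(\<lambda>l. ((?F A l - ?U l) + (?F A l - ?F (Suc ` A) l) + ?F (Suc ` A') l) / 2)
      \<longlonglongrightarrow> (0 + 0 + 1 / 2 ^ n) / 2"
    by (intro tendsto_intros) auto
  \<comment> \<open>The two comparison frequencies split that of the shifted \<open>A'\<close>
    according to \<open>Suc r\<close>, so they cancel exactly.\<close>
  have eq: "((?F A l - ?U l) + (?F A l - ?F (Suc ` A) l) + ?F (Suc ` A') l) / 2 = ?F A l" for l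
  proof -
    have "(\<lambda>N. Suc ` A' \<subseteq> N \<and> Suc r \<in> N) = (\<lambda>N. Suc ` A \<subseteq> N)" using A by auto
    then show ?thesis
      using freq_split[of "\<lambda>N. Suc ` A' \<subseteq> N" l "\<lambda>N. Suc r \<in> N"] by simp
  qed
  show ?case using lim A Suc.hyps(2)[symmetric] unfolding eq by (simp add: mult.commute)
qed

section \<open>The trace over the Fock space\<close>

context fermionic_fock_space
begin

section \<open>Number operators on the monomial basis\<close>

lemma psi_scale: "psi k (c *s v) = c *s psi k v" and psi_zero: "psi k 0 = 0"
proof -
  interpret l: Vector_Spaces.linear scale scale "psi k" by (rule linear_psi)
  show "psi k (c *s v) = c *s psi k v" "psi k 0 = 0"
    by (rule l.scale l.zero)+
qed

lemma psis_scale: "psis k (c *s v) = c *s psis k v" and psis_add: "psis k (v + w) = psis k v + psis k w"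
  and psis_zero: "psis k 0 = 0" and psis_minus: "psis k (- v) = - psis k v"
proof -
  interpret l: Vector_Spaces.linear scale scale "psis k" by (rule linear_psis)
  show "psis k (c *s v) = c *s psis k v" "psis k (v + w) = psis k v + psis k w"
    "psis k 0 = 0" "psis k (- v) = - psis k v"
    by (rule l.scale l.add l.zero l.neg)+
qed

lemma psis_psis_same: "psis k (psis k v) = 0"
proof -
  have "(2 :: complex) *s psis k (psis k v) = psis k (psis k v) + psis k (psis k v)"
    using scale_left_distrib[of 1 1 "psis k (psis k v)"] by simp
  also have "\<dots> = 0" by (rule anticomm_psis_psis)
  finally show ?thesis by simp
qed

text \<open>The operator is \<open>psis (- int e - 1)\<close> after \<open>psi (int e)\<close>. Both
  factors anticommute with \<open>psi (- int n - 1)\<close>, since two negative modes never pair,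
  and the two signs cancel.\<close>

lemma A_coeff_psi:
  "A_coeff (int e) (psi (- int n - 1) v) = psi (- int n - 1) (A_coeff (int e) v)"
proof -
  have "psi (int e) (psi (- int n - 1) v) = - psi (- int n - 1) (psi (int e) v)"
    using anticomm_psi_psi by (metis add.inverse_unique minus_unique)
  moreover have "psis (- int e - 1) (psi (- int n - 1) w) = - psi (- int n - 1) (psis (- int e - 1) w)" for w
    using anticomm_psis_psi[of "- int e - 1" "- int n - 1" w] by (simp add: eq_neg_iff_add_eq_0)
  ultimately show ?thesis
    by (simp add: A_coeff_def A_term_def psis_minus)
qed

text \<open>For \<open>m = e\<close> the anticommutator contributes \<open>v\<close>, and the other
  term dies because the square of \<open>psis (- int e - 1)\<close> is zero. For other
  \<open>m\<close> two signs cancel.\<close>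

lemma A_coeff_psis:
  "A_coeff (int e) (psis (- int m - 1) v) =
    (if m = e then psis (- int m - 1) v else psis (- int m - 1) (A_coeff (int e) v))"
proof -
  have 1: "psi (int e) (psis (- int m - 1) v) =
      (if m = e then v else 0) - psis (- int m - 1) (psi (int e) v)"
    using anticomm_psis_psi[of "- int m - 1" "int e" v] by (auto simp: algebra_simps)
  have 2: "psis (- int e - 1) (psis (- int m - 1) w) = - psis (- int m - 1) (psis (- int e - 1) w)" for w
    using anticomm_psis_psis[of "- int e - 1" "- int m - 1" w] by (simp add: eq_neg_iff_add_eq_0)
  have d: "psis k (v - w) = psis k v - psis k w" for k w
    using psis_add[of k v "- w"] by (simp add: psis_minus)
  show ?thesis
    by (auto simp: A_coeff_def A_term_def 1 d psis_psis_same psis_minus 2)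
qed

text \<open>The operator is moved to the right until it is absorbed by the creation operator with
  \<open>m = e\<close>, or else reaches the vacuum, which \<open>psi (int e)\<close> kills.\<close>

lemma A_coeff_monomial:
  "A_coeff (int e) (monomial s) = (if e \<in> set (snd s) then monomial s else 0)"
proof -
  obtain ns ms where s: "s = (ns, ms)" by force
  have ms: "A_coeff (int e) (foldr (\<lambda>m. psis (- int m - 1)) ms vac) =
      (if e \<in> set ms then foldr (\<lambda>m. psis (- int m - 1)) ms vac else 0)"
  proof (induction ms)
    case Nil
    then show ?case by (simp add: A_coeff_def A_term_def psi_vac psis_zero)
  qed (auto simp: A_coeff_psis psis_zero)
  have "A_coeff (int e) (foldr (\<lambda>n. psi (- int n - 1)) ns v) =
      foldr (\<lambda>n. psi (- int n - 1)) ns (A_coeff (int e) v)" for v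
    by (induction ns) (auto simp: A_coeff_psi)
  moreover have "foldr (\<lambda>n. psi (- int n - 1)) ns 0 = 0"
    by (induction ns) (auto simp: psi_zero)
  ultimately show ?thesis
    by (simp add: s fock_monomial_def ms)
qed

lemma A_coeff_zero: "A_coeff e 0 = 0" and A_coeff_scale: "A_coeff e (c *s v) = c *s A_coeff e v"
  by (simp_all add: A_coeff_def A_term_def psi_zero psis_zero psi_scale psis_scale)

lemma A_coeffs_monomial:
  assumes "\<forall>x\<in>set r. x \<ge> 0"
  shows "foldr (\<circ>) (map A_coeff r) id (c *s monomial s) =
    (if nat ` set r \<subseteq> set (snd s) then c *s monomial s else 0)"
  using assms
proof (induction r)
  case (Cons e r)
  then have "A_coeff e (monomial s) = (if nat e \<in> set (snd s) then monomial s else 0)"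
    using A_coeff_monomial[of "nat e" s] by simp
  with Cons show ?case by (simp add: A_coeff_scale A_coeff_zero)
qed simp

lemma coord_scale_monomial:
  assumes "s \<in> fock_index" "t \<in> fock_index"
  shows "coord t (c *s monomial s) = (if s = t then c else 0)"
proof -
  have "monomial s \<in> monomial ` fock_index" using assms by blast
  moreover have "monomial t = monomial s \<longleftrightarrow> s = t"
    using inj_onD[OF inj_monomial _ assms] by metis
  ultimately show ?thesis
    unfolding coord_def
    by (simp add: representation_scale representation_basis independent_monomials span_monomials)
qed

lemma q_L0_monomial:
  assumes "s \<in> fock_index"
  shows "q_L0 \<tau> (monomial s) = nome_pow \<tau> (fock_weight s - 1 / 24) *s monomial s"
proof -
  have c: "coord t (monomial s) = (if s = t then 1 else 0)" if "t \<in> fock_index" for t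
    using coord_scale_monomial[OF assms that, of 1] by simp
  then have "{t. t \<in> fock_index \<and> coord t (monomial s) \<noteq> 0} = {s}"
    using assms by (auto split: if_splits)
  then show ?thesis
    unfolding q_L0_def using c[OF assms] by simp
qed

text \<open>All factors are diagonal in the monomial basis, so the trace is a sum of eigenvalues,
  and states missing a prescribed mode contribute zero.\<close>

lemma trace0_A_coeffs:
  assumes "\<forall>x\<in>set r. x \<ge> 0"
  shows "trace0 (foldr (\<circ>) (map A_coeff r) id \<circ> q_L0 \<tau>) =
    (\<Sum>\<^sub>\<infinity>s\<in>{s \<in> fock_index. fock_charge s = 0 \<and> nat ` set r \<subseteq> set (snd s)}.
      nome_pow \<tau> (fock_weight s - 1 / 24))"
  unfolding trace0_def
proof (rule infsum_cong_neutral)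
  fix s assume s: "s \<in> {s \<in> fock_index. fock_charge s = 0} \<inter>
    {s \<in> fock_index. fock_charge s = 0 \<and> nat ` set r \<subseteq> set (snd s)}"
  then show "coord s ((foldr (\<circ>) (map A_coeff r) id \<circ> q_L0 \<tau>) (monomial s)) =
      nome_pow \<tau> (fock_weight s - 1 / 24)"
    using assms by (simp add: q_L0_monomial A_coeffs_monomial coord_scale_monomial)
next
  fix s assume s: "s \<in> {s \<in> fock_index. fock_charge s = 0} -
    {s \<in> fock_index. fock_charge s = 0 \<and> nat ` set r \<subseteq> set (snd s)}"
  then show "coord s ((foldr (\<circ>) (map A_coeff r) id \<circ> q_L0 \<tau>) (monomial s)) = 0"
    using assms coord_scale_monomial[of s s 0] by (auto simp: q_L0_monomial A_coeffs_monomial)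
qed auto

end

section \<open>The nome and uniqueness of q-expansions\<close>

lemma norm_nome_less_1: "Im \<tau> > 0 \<Longrightarrow> norm (nome \<tau>) < 1"
  by (simp add: nome_def)

lemma nome_pow_add: "nome_pow \<tau> (a + b) = nome_pow \<tau> a * nome_pow \<tau> b"
  by (simp add: nome_pow_def algebra_simps exp_add)

lemma nome_pow_of_nat: "nome_pow \<tau> (real l) = nome \<tau> ^ l"
  by (simp add: nome_pow_def nome_def mult_ac flip: exp_of_nat_mult)

text \<open>Transfers identities in \<tau> to the punctured unit disc. The logarithm gives a
  preimage, and the norm condition places it in the upper half-plane.\<close>

lemma nome_surj:
  assumes "z \<noteq> 0" "norm z < 1"
  obtains \<tau> where "Im \<tau> > 0" "nome \<tau> = z"
proof -
  define \<tau> where "\<tau> = Ln z / (2 * of_real pi * \<i>)"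
  have \<tau>: "nome \<tau> = z" using assms by (simp add: nome_def \<tau>_def)
  then have "norm (nome \<tau>) < 1" using assms by simp
  then have "Im \<tau> > 0" by (simp add: nome_def zero_less_mult_iff)
  then show ?thesis using \<tau> that by blast
qed

lemma euler_product_nonzero:
  assumes "norm q < 1"
  shows "euler_product q \<noteq> 0"
  unfolding euler_product_def
proof (rule prodinf_nonzero)
  have "summable (\<lambda>m. norm q * norm q ^ m)"
    using assms by (intro summable_mult summable_geometric) auto
  then show "convergent_prod (\<lambda>m. 1 - q ^ Suc m)"
    by (intro abs_convergent_prod_imp_convergent_prod summable_imp_abs_convergent_prod)
      (simp add: norm_mult norm_power)
  fix m
  have "norm (q ^ Suc m) < 1"
    using assms power_Suc_le_self[of "norm q" m] unfolding norm_power by simp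
  then show "1 - q ^ Suc m \<noteq> 0" by auto
qed

lemma powser_sums_0_unique:
  fixes a :: "nat \<Rightarrow> complex"
  assumes "\<And>z. z \<noteq> 0 \<Longrightarrow> norm z < 1 \<Longrightarrow> (\<lambda>n. a n * z ^ n) sums 0"
  shows "a m = 0"
proof (induction m rule: less_induct)
  case (less m)
  have "((\<lambda>_. 0) \<longlongrightarrow> a (0 + m)) (at (0 :: complex))"
  proof (rule powser_limit_0_strong[where s = 1 and a = "\<lambda>n. a (n + m)"])
    fix z :: complex assume z: "z \<noteq> 0" "norm z < 1"
    have "(\<lambda>n. a (n + m) * z ^ (n + m)) sums 0"
      using sums_iff_shift[of "\<lambda>n. a n * z ^ n" m 0] assms[OF z] less by simp
    then have "(\<lambda>n. a (n + m) * z ^ (n + m) / z ^ m) sums (0 / z ^ m)"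
      by (rule sums_divide)
    then show "(\<lambda>n. a (n + m) * z ^ n) sums 0"
      using z by (simp add: power_add)
  qed simp
  then show ?case
    using tendsto_unique[OF _ _ tendsto_const, of "at (0 :: complex)" "0 :: complex"] by simp
qed

lemma is_q_expansion_unique:
  assumes "is_q_expansion b f" "is_q_expansion c f"
  shows "b = c"
proof
  fix m
  have "b m - c m = 0"
  proof (rule powser_sums_0_unique[where a = "\<lambda>m. b m - c m"])
    fix z :: complex assume "z \<noteq> 0" "norm z < 1"
    then obtain \<tau> where "Im \<tau> > 0" "nome \<tau> = z" by (rule nome_surj)
    then show "(\<lambda>n. (b n - c n) * z ^ n) sums 0"
      using assms sums_diff[of "\<lambda>n. b n * z ^ n" "f \<tau>" "\<lambda>n. c n * z ^ n" "f \<tau>"]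
      by (auto simp: is_q_expansion_def left_diff_distrib)
  qed
  then show "b m = c m" by simp
qed

section \<open>Neutral states in Frobenius coordinates\<close>

lemma sorted_wrt_greater_distinct: "sorted_wrt (>) xs \<Longrightarrow> distinct xs"
  for xs :: "'a :: preorder list"
  by (induction xs) auto

definition neutral_states :: "nat set \<Rightarrow> nat \<Rightarrow> (nat list \<times> nat list) set" where
  "neutral_states R l = {s \<in> fock_index. fock_charge s = 0 \<and> R \<subseteq> set (snd s) \<and> fock_weight s = real l}"

lemma fock_weight_neutral:
  assumes "(ns, ms) \<in> fock_index" "fock_charge (ns, ms) = 0"
  shows "fock_weight (ns, ms) = real (\<Sum>(set ms) + \<Sum>(set ns) + card (set ms))"
    and "card (set ms) = card (set ns)"
proof -
  have d: "distinct ns" "distinct ms"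
    using assms(1) by (auto simp: fock_index_def sorted_wrt_greater_distinct)
  have w: "(\<Sum>x\<leftarrow>xs. real x + 1 / 2) = real (\<Sum>(set xs)) + length xs / 2" if "distinct xs" for xs :: "nat list"
    using that by (simp add: sum_list_distinct_conv_sum_set sum.distrib distinct_card)
  show "card (set ms) = card (set ns)"
    using assms(2) d by (simp add: fock_charge_def distinct_card)
  then show "fock_weight (ns, ms) = real (\<Sum>(set ms) + \<Sum>(set ns) + card (set ms))"
    using d by (simp add: fock_weight_def w distinct_card)
qed

text \<open>The components are exchanged: the prescribed modes are \<open>psis\<close> modes, kept
  in the second list, while the condition in \<open>frobenius\<close> restricts the first
  set.\<close>

lemma bij_neutral_states_frobenius:
  "bij_betw (\<lambda>(ns, ms). (set ms, set ns)) (neutral_states R l) (frobenius (\<lambda>N. R \<subseteq> N) l)"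
  unfolding bij_betw_def
proof
  show "inj_on (\<lambda>(ns, ms). (set ms, set ns)) (neutral_states R l)"
    by (rule inj_onI) (auto simp: neutral_states_def fock_index_def intro: sorted_wrt_greater_unique)
  show "(\<lambda>(ns, ms). (set ms, set ns)) ` neutral_states R l = frobenius (\<lambda>N. R \<subseteq> N) l"
  proof (intro equalityI subsetI)
    fix x assume "x \<in> (\<lambda>(ns, ms). (set ms, set ns)) ` neutral_states R l"
    then show "x \<in> frobenius (\<lambda>N. R \<subseteq> N) l"
      using fock_weight_neutral by (auto simp: neutral_states_def frobenius_def simp del: of_nat_add)
  next
    fix x assume x: "x \<in> frobenius (\<lambda>N. R \<subseteq> N) l"
    obtain N M where NM: "x = (N, M)" by force
    with x obtain ns ms where s: "sorted_wrt (>) ns" "set ns = M" "sorted_wrt (>) ms" "set ms = N"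
      by (metis (mono_tags, lifting) case_prodD frobenius_def mem_Collect_eq sorted_wrt_greater_exists)
    then have i: "(ns, ms) \<in> fock_index" by (simp add: fock_index_def)
    have "distinct ns" "distinct ms"
      using s by (auto simp: sorted_wrt_greater_distinct)
    then have c: "fock_charge (ns, ms) = 0"
      using x s NM by (simp add: fock_charge_def frobenius_def flip: distinct_card)
    have "(ns, ms) \<in> neutral_states R l"
      using i c fock_weight_neutral(1)[OF i c] x NM s
      by (simp add: neutral_states_def frobenius_def del: of_nat_add of_nat_sum)
    then show "x \<in> (\<lambda>(ns, ms). (set ms, set ns)) ` neutral_states R l"
      using NM s by force
  qed
qed

section \<open>Convergence and evaluation of the trace\<close>

lemma summable_num_partitions:
  fixes x :: real
  assumes "0 \<le> x" "x < 1"
  shows "summable (\<lambda>l. num_partitions l * x ^ l)"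
proof (cases "x = 0")
  case True
  then show ?thesis by (simp add: summable_0_powser[of "\<lambda>l. real (num_partitions l)", simplified])
next
  case False
  \<comment> \<open>Consecutive ratios of the series tend to \<open>x\<close>, since p(l) / p(l + 1)
    tends to one; any \<open>c\<close> strictly between \<open>x\<close> and one then serves in the
    ratio test.\<close>
  obtain c where c: "x < c" "c < 1" using assms dense by blast
  have "c > 0" using c assms by linarith
  have "x / c < 1" using c \<open>c > 0\<close> by simp
  then have "\<forall>\<^sub>F l in sequentially. num_partitions l / num_partitions (Suc l) > x / c"
    using order_tendstoD(1)[OF num_partitions_ratio] by blast
  then obtain L where L: "\<And>l. l \<ge> L \<Longrightarrow> num_partitions l / num_partitions (Suc l) > x / c"
    by (auto simp: eventually_sequentially)
  show ?thesis
  proof (rule summable_ratio_test[OF c(2)])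
    fix l assume "l \<ge> L"
    then have "x * num_partitions (Suc l) \<le> c * num_partitions l"
      using L[of l] num_partitions_pos[of "Suc l"] \<open>c > 0\<close> by (simp add: field_simps)
    then have "x * num_partitions (Suc l) * x ^ l \<le> c * num_partitions l * x ^ l"
      using assms by (intro mult_right_mono) auto
    then show "norm (num_partitions (Suc l) * x ^ Suc l) \<le> c * norm (num_partitions l * x ^ l)"
      using assms by (simp add: mult_ac)
  qed
qed

text \<open>Grouping the states by weight is legitimate by absolute convergence, the partition
  series being a majorant.\<close>

lemma neutral_states_sums:
  fixes q :: complex
  assumes "norm q < 1"
  shows "((\<lambda>(l, s). q ^ l) has_sum (\<Sum>l. of_nat (card (frobenius (\<lambda>N. R \<subseteq> N) l)) * q ^ l))
      (Sigma UNIV (neutral_states R))"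
    and "summable (\<lambda>l. of_nat (card (frobenius (\<lambda>N. R \<subseteq> N) l)) * q ^ l)"
proof -
  let ?u = "\<lambda>l. card (frobenius (\<lambda>N. R \<subseteq> N) l)"
  have fin: "finite (neutral_states R l)" and card: "card (neutral_states R l) = ?u l" for l
    using bij_betw_finite[OF bij_neutral_states_frobenius] bij_betw_same_card[OF bij_neutral_states_frobenius]
    by (auto simp: finite_frobenius)
  have sm: "summable (\<lambda>l. norm (of_nat (?u l) * q ^ l))"
  proof (rule summable_comparison_test)
    show "summable (\<lambda>l. num_partitions l * norm q ^ l)"
      using assms by (intro summable_num_partitions) auto
    show "\<exists>L. \<forall>l\<ge>L. norm (norm (of_nat (?u l) * q ^ l)) \<le> num_partitions l * norm q ^ l"
      by (intro exI allI impI)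
        (simp add: norm_mult norm_power card_frobenius_le mult_right_mono)
  qed
  then show s: "summable (\<lambda>l. of_nat (?u l) * q ^ l)" by (rule summable_norm_cancel)
  show "((\<lambda>(l, s). q ^ l) has_sum (\<Sum>l. of_nat (?u l) * q ^ l)) (Sigma UNIV (neutral_states R))"
  proof (rule has_sum_SigmaI)
    show "((\<lambda>s. case (l, s) of (l, s) \<Rightarrow> q ^ l) has_sum (of_nat (?u l) * q ^ l)) (neutral_states R l)" for l
      using has_sum_finite[OF fin[of l], of "\<lambda>_. q ^ l"] by (simp add: card)
    show "((\<lambda>l. of_nat (?u l) * q ^ l) has_sum (\<Sum>l. of_nat (?u l) * q ^ l)) UNIV"
      using sm s by (intro norm_summable_imp_has_sum summable_sums)
    have "(\<lambda>x. norm (case x of (l, s) \<Rightarrow> q ^ l)) summable_on Sigma UNIV (neutral_states R)"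
    proof (rule summable_on_SigmaI)
      show "((\<lambda>s. norm (case (l, s) of (l, s) \<Rightarrow> q ^ l)) has_sum (norm (of_nat (?u l) * q ^ l)))
          (neutral_states R l)" for l
        using has_sum_finite[OF fin[of l], of "\<lambda>_. norm (q ^ l)"] by (simp add: card norm_mult)
      show "(\<lambda>l. norm (of_nat (?u l) * q ^ l)) summable_on UNIV"
        using sm by (intro norm_summable_imp_summable_on) simp
    qed auto
    then show "(\<lambda>(l, s). q ^ l) summable_on Sigma UNIV (neutral_states R)"
      by (rule abs_summable_summable)
  qed
qed

lemma infsum_neutral_states:
  assumes "Im \<tau> > 0"
  shows "(\<Sum>\<^sub>\<infinity>s\<in>{s \<in> fock_index. fock_charge s = 0 \<and> R \<subseteq> set (snd s)}.
      nome_pow \<tau> (fock_weight s - 1 / 24)) =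
    nome_pow \<tau> (- 1 / 24) * (\<Sum>l. of_nat (card (frobenius (\<lambda>N. R \<subseteq> N) l)) * nome \<tau> ^ l)"
proof -
  let ?S = "{s \<in> fock_index. fock_charge s = 0 \<and> R \<subseteq> set (snd s)}"
  have bij: "bij_betw snd (Sigma UNIV (neutral_states R)) ?S"
    unfolding bij_betw_def
  proof
    show "inj_on snd (Sigma UNIV (neutral_states R))"
      by (auto simp: inj_on_def neutral_states_def)
    \<comment> \<open>At charge zero the weight is an integer, so every state occurs at some level
      \<open>l\<close>.\<close>
    have "\<exists>l. fock_weight s = real l" if "s \<in> ?S" for s
      using that fock_weight_neutral(1)[of "fst s" "snd s"] by (metis (mono_tags, lifting) mem_Collect_eq prod.collapse)
    then show "snd ` Sigma UNIV (neutral_states R) = ?S"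
      by (force simp: neutral_states_def image_iff)
  qed
  have "(\<Sum>\<^sub>\<infinity>s\<in>?S. nome_pow \<tau> (fock_weight s - 1 / 24)) =
      (\<Sum>\<^sub>\<infinity>x\<in>Sigma UNIV (neutral_states R). nome_pow \<tau> (fock_weight (snd x) - 1 / 24))"
    by (rule infsum_reindex_bij_betw[OF bij, symmetric])
  also have "\<dots> = (\<Sum>\<^sub>\<infinity>x\<in>Sigma UNIV (neutral_states R). nome_pow \<tau> (- 1 / 24) * (case x of (l, s) \<Rightarrow> nome \<tau> ^ l))"
  proof (rule infsum_cong)
    fix x assume "x \<in> Sigma UNIV (neutral_states R)"
    then show "nome_pow \<tau> (fock_weight (snd x) - 1 / 24) =
        nome_pow \<tau> (- 1 / 24) * (case x of (l, s) \<Rightarrow> nome \<tau> ^ l)"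
      using nome_pow_add[of \<tau> "- 1 / 24" "real (fst x)"]
      by (auto simp: neutral_states_def nome_pow_of_nat)
  qed
  also have "\<dots> = nome_pow \<tau> (- 1 / 24) * (\<Sum>\<^sub>\<infinity>x\<in>Sigma UNIV (neutral_states R). case x of (l, s) \<Rightarrow> nome \<tau> ^ l)"
    by (rule infsum_cmult_right')
  also have "(\<Sum>\<^sub>\<infinity>x\<in>Sigma UNIV (neutral_states R). case x of (l, s) \<Rightarrow> nome \<tau> ^ l) =
      (\<Sum>l. of_nat (card (frobenius (\<lambda>N. R \<subseteq> N) l)) * nome \<tau> ^ l)"
    by (rule infsumI[OF neutral_states_sums(1)[OF norm_nome_less_1[OF assms]]])
  finally show ?thesis .
qed

lemma (in fermionic_fock_space) npoint_coeff_q_expansion: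
  assumes "\<forall>x\<in>set r. x \<ge> 0"
  shows "is_q_expansion (\<lambda>l. of_nat (card (frobenius (\<lambda>N. nat ` set r \<subseteq> N) l)))
    (\<lambda>\<tau>. npoint_coeff r \<tau> / euler_product (nome \<tau>))"
  unfolding is_q_expansion_def
proof (intro allI impI)
  fix \<tau> assume \<tau>: "Im \<tau> > 0"
  let ?u = "\<lambda>l. of_nat (card (frobenius (\<lambda>N. nat ` set r \<subseteq> N) l)) * nome \<tau> ^ l"
  \<comment> \<open>The fractional power in the eta function cancels the one from
    \<open>q_L0\<close>; the remaining Euler product is the divisor in the claim.\<close>
  have "nome_pow \<tau> (1 / 24) * nome_pow \<tau> (- 1 / 24) = 1"
    unfolding nome_pow_add[symmetric] by (simp add: nome_pow_def)
  then have "npoint_coeff r \<tau> = euler_product (nome \<tau>) * (\<Sum>l. ?u l)"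
    unfolding npoint_coeff_def dedekind_eta_def trace0_A_coeffs[OF assms] infsum_neutral_states[OF \<tau>]
    by (simp add: mult_ac)
  then have "npoint_coeff r \<tau> / euler_product (nome \<tau>) = (\<Sum>l. ?u l)"
    using euler_product_nonzero[OF norm_nome_less_1[OF \<tau>]] by simp
  then show "?u sums (npoint_coeff r \<tau> / euler_product (nome \<tau>))"
    using summable_sums[OF neutral_states_sums(2)[OF norm_nome_less_1[OF \<tau>]]] by simp
qed

theorem theorem3p3:
  fixes scale :: "complex \<Rightarrow> 'v::ab_group_add \<Rightarrow> 'v"
    and psi psis :: "int \<Rightarrow> 'v \<Rightarrow> 'v" and vac :: 'v
    and n :: nat and r :: "int list"
  assumes "fermionic_fock_space scale psi psis vac"
    and "n \<ge> 1" and "length r = n" and "sorted_wrt (>) r" and "\<forall>x\<in>set r. x \<ge> 0"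
  shows "(\<exists>b. is_q_expansion b (\<lambda>\<tau>.
        fermionic_fock_space.npoint_coeff scale psi psis vac r \<tau> / euler_product (nome \<tau>))) \<and>
    (\<forall>b. is_q_expansion b (\<lambda>\<tau>.
        fermionic_fock_space.npoint_coeff scale psi psis vac r \<tau> / euler_product (nome \<tau>)) \<longrightarrow>
      b \<sim>[at_top] (\<lambda>l. of_nat (num_partitions l) / 2 ^ n))"
proof -
  interpret fermionic_fock_space scale psi psis vac by fact
  let ?R = "nat ` set r"
  let ?b = "\<lambda>l. of_nat (card (frobenius (\<lambda>N. ?R \<subseteq> N) l)) :: complex"
  have exp: "is_q_expansion ?b (\<lambda>\<tau>. npoint_coeff r \<tau> / euler_product (nome \<tau>))"
    using assms by (intro npoint_coeff_q_expansion)
  \<comment> \<open>Strict decrease and nonnegativity make \<open>r\<close> a set of exactly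
    \<open>n\<close> natural numbers, which gives the exponent \<open>n\<close> of two.\<close>
  have "distinct r"
    using assms(4) by (rule sorted_wrt_greater_distinct)
  moreover have "inj_on nat (set r)"
    using assms(5) by (auto simp: inj_on_def eq_nat_nat_iff)
  ultimately have "card ?R = n"
    using assms(3) by (simp add: card_image distinct_card)
  then have "freq (\<lambda>N. ?R \<subseteq> N) \<longlonglongrightarrow> 1 / 2 ^ n"
    using freq_limit[of ?R] by simp
  then have "(\<lambda>l. complex_of_real (freq (\<lambda>N. ?R \<subseteq> N) l * 2 ^ n)) \<longlonglongrightarrow> complex_of_real (1 / 2 ^ n * 2 ^ n)"
    by (intro tendsto_of_real tendsto_intros)
  then have "(\<lambda>l. ?b l / (of_nat (num_partitions l) / 2 ^ n)) \<longlonglongrightarrow> 1"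
    by (simp add: freq_def)
  then have "?b \<sim>[at_top] (\<lambda>l. of_nat (num_partitions l) / 2 ^ n)"
    using num_partitions_pos by (intro asymp_equivI') auto
  with exp show ?thesis
    using is_q_expansion_unique[OF _ exp] by blast
qed

end
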